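(* Let $d,N\ge 1$ be integers, let $\vec M_1,\dots,\vec M_N\in\mathbb{Z}^d$ be pairwise distinct, and let $Q=\bigcup_{p=1}^N (Q_0+\vec M_p)$ with $Q_0=[-\tfrac12,\tfrac12)^d$. Let $\vec\delta_1,\dots,\vec\delta_N\in\mathbb{R}^d$ and let $\mathcal{B}=\bigcup_{j=1}^N\{e^{2\pi i\langle \vec n+\vec\delta_j,\,x\rangle}\}_{\vec n\in\mathbb{Z}^d}$. The following are equivalent: (i) $\mathcal{B}$ is a Riesz sequence in $L^2(Q)$; (ii) $\mathcal{B}$ is a frame of $L^2(Q)$; (iii) $\mathcal{B}$ is a Riesz basis of $L^2(Q)$.
   Context: The set $\mathcal{B}$ is regarded as a family indexed by $(j,\vec n)\in\{1,\dots,N\}\times\mathbb{Z}^d$ of functions of $x$ restricted to $Q$. A countable family $\{v_k\}$ in a separable Hilbert space $H$ is a frame if there are $A,B>0$ with $A\|w\|^2\le\sum_k|\langle w,v_k\rangle|^2\le B\|w\|^2$ for all $w\in H$; it is a Riesz sequence if there are $A,B>0$ with $A\sum_{k\in J}|a_k|^2\le\|\sum_{k\in J}a_kv_k\|^2\le B\sum_{k\in J}|a_k|^2$ for all finite families $\{a_k\}_{k\in J}$ of complex numbers; it is a Riesz basis if it is both. *)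

theory Defs
  imports "HOL-Analysis.Analysis"
begin

section \<open>Frames and Riesz sequences in $L^2$ of a measure space\<close>

text \<open>
  Elements of $L^2(M)$ are represented by functions rather than by classes modulo equality almost
  everywhere. All notions below depend only on the almost-everywhere classes, and, for
  \<open>M = lebesgue_on Q\<close>, only on the restrictions of the functions to \<open>Q\<close>.
\<close>

definition L2 :: "'a measure \<Rightarrow> ('a \<Rightarrow> complex) set" where
  "L2 M = {f \<in> borel_measurable M. integrable M (\<lambda>x. (cmod (f x))\<^sup>2)}"

definition L2_inner :: "'a measure \<Rightarrow> ('a \<Rightarrow> complex) \<Rightarrow> ('a \<Rightarrow> complex) \<Rightarrow> complex" where
  "L2_inner M f g = integral\<^sup>L M (\<lambda>x. f x * cnj (g x))"

definition L2_norm :: "'a measure \<Rightarrow> ('a \<Rightarrow> complex) \<Rightarrow> real" where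
  "L2_norm M f = sqrt (Re (L2_inner M f f))"

definition L2_family :: "'a measure \<Rightarrow> 'k set \<Rightarrow> ('k \<Rightarrow> 'a \<Rightarrow> complex) \<Rightarrow> bool" where
  "L2_family M I v \<longleftrightarrow> countable I \<and> (\<forall>k\<in>I. v k \<in> L2 M)"

text \<open>
  Summability is demanded explicitly because \<open>infsum\<close> is 0 on non-summable families, whereas the
  upper frame bound is meant to force convergence.
\<close>

definition L2_frame :: "'a measure \<Rightarrow> 'k set \<Rightarrow> ('k \<Rightarrow> 'a \<Rightarrow> complex) \<Rightarrow> bool" where
  "L2_frame M I v \<longleftrightarrow> L2_family M I v \<and>
     (\<exists>A>0. \<exists>B>0. \<forall>w\<in>L2 M.
        (\<lambda>k. (cmod (L2_inner M w (v k)))\<^sup>2) summable_on I \<and>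
        A * (L2_norm M w)\<^sup>2 \<le> (\<Sum>\<^sub>\<infinity>k\<in>I. (cmod (L2_inner M w (v k)))\<^sup>2) \<and>
        (\<Sum>\<^sub>\<infinity>k\<in>I. (cmod (L2_inner M w (v k)))\<^sup>2) \<le> B * (L2_norm M w)\<^sup>2)"

definition L2_Riesz_sequence :: "'a measure \<Rightarrow> 'k set \<Rightarrow> ('k \<Rightarrow> 'a \<Rightarrow> complex) \<Rightarrow> bool" where
  "L2_Riesz_sequence M I v \<longleftrightarrow> L2_family M I v \<and>
     (\<exists>A>0. \<exists>B>0. \<forall>J a. finite J \<and> J \<subseteq> I \<longrightarrow>
        A * (\<Sum>k\<in>J. (cmod (a k))\<^sup>2) \<le> (L2_norm M (\<lambda>x. \<Sum>k\<in>J. a k * v k x))\<^sup>2 \<and>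
        (L2_norm M (\<lambda>x. \<Sum>k\<in>J. a k * v k x))\<^sup>2 \<le> B * (\<Sum>k\<in>J. (cmod (a k))\<^sup>2))"

definition L2_Riesz_basis :: "'a measure \<Rightarrow> 'k set \<Rightarrow> ('k \<Rightarrow> 'a \<Rightarrow> complex) \<Rightarrow> bool" where
  "L2_Riesz_basis M I v \<longleftrightarrow> L2_frame M I v \<and> L2_Riesz_sequence M I v"

section \<open>Unions of translated unit cubes and exponentials\<close>

definition real_vec :: "int ^ 'd \<Rightarrow> real ^ 'd" where
  "real_vec n = (\<chi> i. real_of_int (n $ i))"

definition unit_cube :: "(real ^ 'd) set" where
  "unit_cube = {x. \<forall>i. - 1 / 2 \<le> x $ i \<and> x $ i < 1 / 2}"

definition multi_cube :: "nat \<Rightarrow> (nat \<Rightarrow> int ^ 'd) \<Rightarrow> (real ^ 'd) set" where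
  "multi_cube N M = (\<Union>p\<in>{1..N}. (\<lambda>x. x + real_vec (M p)) ` unit_cube)"

definition exp_family :: "(nat \<Rightarrow> real ^ 'd) \<Rightarrow> nat \<times> (int ^ 'd) \<Rightarrow> real ^ 'd \<Rightarrow> complex" where
  "exp_family \<delta> = (\<lambda>(j, n) x. exp (2 * of_real pi * \<i> * of_real ((real_vec n + \<delta> j) \<bullet> x)))"

end

theory Submission
  imports Defs "Jordan_Normal_Form.Determinant"
begin

text \<open>
  Since the inner product of two integer vectors is an integer, translating every cube of \<open>Q\<close> back to
  \<open>Q\<^sub>0\<close> makes the dependence on the cube constant in \<open>x\<close> and \<open>n\<close>: with the matrix
  \<open>U j p = exp (- 2 \<pi> i \<langle>\<delta> j, M p\<rangle>)\<close> and \<open>W x = (w (x + M p))\<^sub>p\<close>, the coefficients of \<open>w\<close> against the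
  \<open>j\<close>-th block of exponentials are the Fourier coefficients on \<open>Q\<^sub>0\<close> of \<open>exp (- 2 \<pi> i \<langle>\<delta> j, x\<rangle>) (U W x)\<^sub>j\<close>.
  By Parseval the frame inequality compares the integrals of \<open>|U W|\<^sup>2\<close> and \<open>|W|\<^sup>2\<close>, so it holds iff \<open>U\<close> is
  injective. Dually, the Riesz inequality compares \<open>|U\<^sup>* H|\<^sup>2\<close> and \<open>|H|\<^sup>2\<close> for vectors \<open>H\<close> of modulated
  trigonometric polynomials, which are dense, so it holds iff \<open>U\<^sup>*\<close> is injective. As \<open>U\<close> is square, the two
  conditions coincide.
\<close>

section \<open>Square linear systems\<close>

text \<open>The case split is on the determinant. The inverse is delivered from both sides because
  the frame property uses a left inverse and the Riesz property a right inverse. If the determinant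
  vanishes, so does that of the transpose, which supplies the left kernel vector \<open>c\<close>
  next to the right kernel vector \<open>v\<close>. This is where the squareness of the system
  enters.\<close>

lemma square_system_alternative:
  fixes U :: "nat \<Rightarrow> nat \<Rightarrow> 'a::field"
  obtains
    (invertible) V where
      "\<And>p q. p \<in> {1..N} \<Longrightarrow> q \<in> {1..N} \<Longrightarrow> (\<Sum>j=1..N. V p j * U j q) = (if p = q then 1 else 0)"
      "\<And>j k. j \<in> {1..N} \<Longrightarrow> k \<in> {1..N} \<Longrightarrow> (\<Sum>p=1..N. U j p * V p k) = (if j = k then 1 else 0)"
  | (singular) v c where
      "\<exists>p\<in>{1..N}. v p \<noteq> 0" "\<And>j. j \<in> {1..N} \<Longrightarrow> (\<Sum>p=1..N. U j p * v p) = 0"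
      "\<exists>j\<in>{1..N}. c j \<noteq> 0" "\<And>p. p \<in> {1..N} \<Longrightarrow> (\<Sum>j=1..N. c j * U j p) = 0"
proof -
  \<comment> \<open>Matrix entries are numbered from 0, the sums of the statement from 1; hence the
    shifts by \<open>Suc\<close> and \<open>- 1\<close> throughout.\<close>
  define A where "A = Matrix.mat N N (\<lambda>(i, k). U (Suc i) (Suc k))"
  have A: "A \<in> carrier_mat N N" by (simp add: A_def)
  have shift: "(\<Sum>j=1..N. f j) = (\<Sum>j=0..<N. f (Suc j))" for f :: "nat \<Rightarrow> 'a"
    by (simp add: sum.atLeast1_atMost_eq atLeast0LessThan)
  \<comment> \<open>Stated for an arbitrary \<open>B\<close> so that it applies to \<open>U\<close>
    and to its transpose.\<close>
  have kernel: "\<exists>v. (\<exists>p\<in>{1..N}. v p \<noteq> 0) \<and> (\<forall>j\<in>{1..N}. (\<Sum>p=1..N. B (j - 1) (p - 1) * v p) = 0)"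
    if B: "Determinant.det (Matrix.mat N N (\<lambda>(i, k). B i k)) = 0" for B :: "nat \<Rightarrow> nat \<Rightarrow> 'a"
  proof -
    let ?B = "Matrix.mat N N (\<lambda>(i, k). B i k)"
    obtain w where w: "w \<in> carrier_vec N" "w \<noteq> 0\<^sub>v N" "?B *\<^sub>v w = 0\<^sub>v N"
      using iffD1[OF det_0_iff_vec_prod_zero[OF mat_carrier] B] by blast
    then obtain i where i: "i < N" "vec_index w i \<noteq> 0"
      by (metis carrier_vecD eq_vecI index_zero_vec)
    have "(\<Sum>k=0..<N. B j k * vec_index w k) = 0" if "j < N" for j
    proof -
      have "vec_index (?B *\<^sub>v w) j = 0" using w(3) that by simp
      then show ?thesis using that w(1) by (simp add: scalar_prod_def)
    qed
    then have "\<forall>j\<in>{1..N}. (\<Sum>p=1..N. B (j - 1) (p - 1) * vec_index w (p - 1)) = 0"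
      unfolding shift by auto
    moreover have "vec_index w (Suc i - 1) \<noteq> 0" "Suc i \<in> {1..N}" using i by auto
    ultimately show ?thesis
      by (intro exI[of _ "\<lambda>p. vec_index w (p - 1)"]) blast
  qed
  show thesis
  proof (cases "Determinant.det A = 0")
    case True
    obtain v where v: "\<exists>p\<in>{1..N}. v p \<noteq> 0" "\<forall>j\<in>{1..N}. (\<Sum>p=1..N. U (Suc (j - 1)) (Suc (p - 1)) * v p) = 0"
      using kernel[of "\<lambda>i k. U (Suc i) (Suc k)"] True unfolding A_def by auto
    have "transpose_mat A = Matrix.mat N N (\<lambda>(i, k). U (Suc k) (Suc i))"
      by (auto simp: A_def)
    then obtain c where c: "\<exists>p\<in>{1..N}. c p \<noteq> 0" "\<forall>j\<in>{1..N}. (\<Sum>p=1..N. U (Suc (p - 1)) (Suc (j - 1)) * c p) = 0"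
      using kernel[of "\<lambda>i k. U (Suc k) (Suc i)"] True det_transpose[OF A] by auto
    show thesis
    proof (rule singular[of v c])
      show "(\<Sum>p=1..N. U j p * v p) = 0" if "j \<in> {1..N}" for j
        using v(2) that by (auto intro!: trans[OF sum.cong])
      show "(\<Sum>j=1..N. c j * U j p) = 0" if "p \<in> {1..N}" for p
        using c(2) that by (auto intro!: trans[OF sum.cong] simp: mult.commute)
    qed (use v c in auto)
  next
    case False
    \<comment> \<open>A unit of the matrix ring has a two-sided inverse, so a single
      \<open>B\<close> yields both families of equations.\<close>
    from det_non_zero_imp_unit[OF A False, of "()"]
    obtain B where B: "B \<in> carrier_mat N N" "B * A = 1\<^sub>m N" "A * B = 1\<^sub>m N"
      unfolding Units_def ring_mat_def by auto
    show thesis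
    proof (rule invertible[of "\<lambda>p j. index_mat B (p - 1, j - 1)"])
      fix p q assume pq: "p \<in> {1..N}" "q \<in> {1..N}"
      have "index_mat (B * A) (p - 1, q - 1) = (if p = q then 1 else 0)"
        using pq B(2) by auto
      moreover have "index_mat (B * A) (p - 1, q - 1) = (\<Sum>j=0..<N. index_mat B (p - 1, j) * U (Suc j) q)"
        using pq B(1) by (auto simp: scalar_prod_def A_def)
      ultimately show "(\<Sum>j=1..N. index_mat B (p - 1, j - 1) * U j q) = (if p = q then 1 else 0)"
        unfolding shift by simp
    next
      fix j k assume jk: "j \<in> {1..N}" "k \<in> {1..N}"
      have "index_mat (A * B) (j - 1, k - 1) = (if j = k then 1 else 0)"
        using jk B(3) by auto
      moreover have "index_mat (A * B) (j - 1, k - 1) = (\<Sum>p=0..<N. U j (Suc p) * index_mat B (p, k - 1))"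
        using jk B(1) by (auto simp: scalar_prod_def A_def)
      ultimately show "(\<Sum>p=1..N. U j p * index_mat B (p - 1, k - 1)) = (if j = k then 1 else 0)"
        unfolding shift by simp
    qed
  qed
qed

no_notation vec_index (infixl \<open>$\<close> 100) and scalar_prod (infix \<open>\<bullet>\<close> 70)

section \<open>Upper and lower norm bounds for matrices\<close>

lemma cmod_sum_mult_le:
  "(cmod (\<Sum>k\<in>T. a k * b k))\<^sup>2 \<le> (\<Sum>k\<in>T. (cmod (a k))\<^sup>2) * (\<Sum>k\<in>T. (cmod (b k))\<^sup>2)"
proof -
  have "cmod (\<Sum>k\<in>T. a k * b k) \<le> (\<Sum>k\<in>T. cmod (a k) * cmod (b k))"
    by (rule norm_sum[THEN order_trans]) (simp add: norm_mult)
  then have "(cmod (\<Sum>k\<in>T. a k * b k))\<^sup>2 \<le> (\<Sum>k\<in>T. cmod (a k) * cmod (b k))\<^sup>2"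
    by (rule power_mono) simp
  also have "\<dots> \<le> (\<Sum>k\<in>T. (cmod (a k))\<^sup>2) * (\<Sum>k\<in>T. (cmod (b k))\<^sup>2)"
    by (rule Cauchy_Schwarz_ineq_sum)
  finally show ?thesis .
qed

text \<open>Cauchy-Schwarz in every row, summed over the rows. The crude Frobenius constant is
  enough, since only the existence of an upper bound matters.\<close>

lemma Frobenius_norm_bound:
  "(\<Sum>i\<in>S. (cmod (\<Sum>k\<in>T. B i k * v k))\<^sup>2)
     \<le> (\<Sum>i\<in>S. \<Sum>k\<in>T. (cmod (B i k))\<^sup>2) * (\<Sum>k\<in>T. (cmod (v k))\<^sup>2)"
  unfolding sum_distrib_right by (rule sum_mono, rule cmod_sum_mult_le[unfolded sum_distrib_right])

text \<open>Since \<open>v = V (U v)\<close>, the upper bound for \<open>V\<close> is a lower bound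
  for \<open>U\<close>. With \<open>K\<close> the squared Frobenius norm of \<open>V\<close> the
  constant is \<open>1 / (K + 1)\<close>, where the added 1 rules out division by 0.\<close>

lemma left_inverse_lower_bound:
  fixes U V :: "nat \<Rightarrow> nat \<Rightarrow> complex"
  assumes "\<And>p q. p \<in> {1..N} \<Longrightarrow> q \<in> {1..N} \<Longrightarrow> (\<Sum>j=1..N. V p j * U j q) = (if p = q then 1 else 0)"
  obtains A where "A > 0"
    "\<And>v. A * (\<Sum>p=1..N. (cmod (v p))\<^sup>2) \<le> (\<Sum>j=1..N. (cmod (\<Sum>p=1..N. U j p * v p))\<^sup>2)"
proof -
  define K where "K = (\<Sum>p=1..N. \<Sum>j=1..N. (cmod (V p j))\<^sup>2)"
  have K: "K \<ge> 0" by (simp add: K_def sum_nonneg)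
  have bound: "(\<Sum>p=1..N. (cmod (v p))\<^sup>2) \<le> (K + 1) * (\<Sum>j=1..N. (cmod (\<Sum>p=1..N. U j p * v p))\<^sup>2)" for v
  proof -
    have "v p = (\<Sum>j=1..N. V p j * (\<Sum>q=1..N. U j q * v q))" if p: "p \<in> {1..N}" for p
    proof -
      have "(\<Sum>j=1..N. V p j * (\<Sum>q=1..N. U j q * v q)) = (\<Sum>q=1..N. \<Sum>j=1..N. V p j * U j q * v q)"
        unfolding sum_distrib_left by (subst sum.swap) (simp add: mult.assoc)
      also have "\<dots> = (\<Sum>q=1..N. (if p = q then 1 else 0) * v q)"
        unfolding sum_distrib_right[symmetric] using assms[OF p] by (intro sum.cong) auto
      also have "\<dots> = v p" using p by (simp add: if_distrib[of "\<lambda>x. x * _"] sum.delta cong: if_cong)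
      finally show ?thesis by simp
    qed
    then have "(\<Sum>p=1..N. (cmod (v p))\<^sup>2) = (\<Sum>p=1..N. (cmod (\<Sum>j=1..N. V p j * (\<Sum>q=1..N. U j q * v q)))\<^sup>2)"
      by (intro sum.cong) auto
    also have "\<dots> \<le> K * (\<Sum>j=1..N. (cmod (\<Sum>q=1..N. U j q * v q))\<^sup>2)"
      unfolding K_def by (rule Frobenius_norm_bound)
    also have "\<dots> \<le> (K + 1) * (\<Sum>j=1..N. (cmod (\<Sum>q=1..N. U j q * v q))\<^sup>2)"
      by (intro mult_right_mono sum_nonneg) auto
    finally show ?thesis .
  qed
  show thesis
  proof (rule that[of "1 / (K + 1)"])
    show "1 / (K + 1) > 0" using K by simp
    show "1 / (K + 1) * (\<Sum>p=1..N. (cmod (v p))\<^sup>2) \<le> (\<Sum>j=1..N. (cmod (\<Sum>p=1..N. U j p * v p))\<^sup>2)" for v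
      using bound[of v] K by (simp add: divide_le_eq mult.commute)
  qed
qed

section \<open>The space $L^2$\<close>

lemma L2_norm_sq: "(L2_norm M f)\<^sup>2 = (\<integral>x. (cmod (f x))\<^sup>2 \<partial>M)"
proof -
  have "L2_inner M f f = (\<integral>x. complex_of_real ((cmod (f x))\<^sup>2) \<partial>M)"
    unfolding L2_inner_def by (simp only: complex_norm_square)
  also have "\<dots> = complex_of_real (\<integral>x. (cmod (f x))\<^sup>2 \<partial>M)"
    by (rule integral_complex_of_real)
  finally have "Re (L2_inner M f f) = (\<integral>x. (cmod (f x))\<^sup>2 \<partial>M)" by simp
  then show ?thesis by (simp add: L2_norm_def)
qed

lemma L2_inner_self: "L2_inner M f f = of_real ((L2_norm M f)\<^sup>2)"
  unfolding L2_norm_sq L2_inner_def by (simp only: complex_norm_square[symmetric] integral_complex_of_real)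

lemma cmod_mult_cnj_le: "cmod (z * cnj w) \<le> (cmod z)\<^sup>2 + (cmod w)\<^sup>2"
proof -
  have "2 * (cmod z * cmod w) \<le> (cmod z)\<^sup>2 + (cmod w)\<^sup>2"
    using sum_squares_bound[of "cmod z" "cmod w"] by (simp add: mult.assoc)
  moreover have "0 \<le> cmod z * cmod w" by simp
  ultimately have "cmod z * cmod w \<le> (cmod z)\<^sup>2 + (cmod w)\<^sup>2" by linarith
  then show ?thesis by (simp add: norm_mult)
qed

lemma cmod_add_sq_le: "(cmod (z + w))\<^sup>2 \<le> 2 * (cmod z)\<^sup>2 + 2 * (cmod w)\<^sup>2"
proof -
  have "(cmod (z + w))\<^sup>2 \<le> (cmod z + cmod w)\<^sup>2"
    by (intro power_mono norm_triangle_ineq) simp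
  also have "\<dots> \<le> 2 * (cmod z)\<^sup>2 + 2 * (cmod w)\<^sup>2"
    using sum_squares_bound[of "cmod z" "cmod w"] by (simp add: power2_sum)
  finally show ?thesis .
qed

lemma L2_integrable: "f \<in> L2 M \<Longrightarrow> integrable M (\<lambda>x. (cmod (f x))\<^sup>2)"
  and L2_measurable: "f \<in> L2 M \<Longrightarrow> f \<in> borel_measurable M"
  by (auto simp: L2_def)

lemma L2_integrable_mult_cnj:
  assumes "f \<in> L2 M" "g \<in> L2 M"
  shows "integrable M (\<lambda>x. f x * cnj (g x))"
proof (rule Bochner_Integration.integrable_bound)
  show "integrable M (\<lambda>x. (cmod (f x))\<^sup>2 + (cmod (g x))\<^sup>2)"
    using assms by (intro Bochner_Integration.integrable_add L2_integrable)
  have [measurable]: "f \<in> borel_measurable M" "g \<in> borel_measurable M"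
    using assms by (auto simp: L2_def)
  have "(\<lambda>x. cnj (g x)) \<in> borel_measurable M"
    by (rule measurable_compose[OF _ borel_measurable_continuous_onI]) (auto intro: continuous_intros)
  then show "(\<lambda>x. f x * cnj (g x)) \<in> borel_measurable M" by measurable
  show "AE x in M. norm (f x * cnj (g x)) \<le> norm ((cmod (f x))\<^sup>2 + (cmod (g x))\<^sup>2)"
    using cmod_mult_cnj_le by (intro AE_I2) (simp add: abs_of_nonneg)
qed

lemma L2_add:
  assumes "f \<in> L2 M" "g \<in> L2 M"
  shows "(\<lambda>x. f x + g x) \<in> L2 M"
proof -
  have [measurable]: "f \<in> borel_measurable M" "g \<in> borel_measurable M"
    using assms by (auto simp: L2_def)
  have "integrable M (\<lambda>x. (cmod (f x + g x))\<^sup>2)"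
  proof (rule Bochner_Integration.integrable_bound)
    show "integrable M (\<lambda>x. 2 * (cmod (f x))\<^sup>2 + 2 * (cmod (g x))\<^sup>2)"
      using assms by (intro Bochner_Integration.integrable_add integrable_mult_right L2_integrable)
    show "AE x in M. norm ((cmod (f x + g x))\<^sup>2) \<le> norm (2 * (cmod (f x))\<^sup>2 + 2 * (cmod (g x))\<^sup>2)"
      using cmod_add_sq_le by (intro AE_I2) (simp add: abs_of_nonneg)
  qed measurable
  then show ?thesis by (simp add: L2_def)
qed

text \<open>The common source of three closure properties: scalar multiples, bounded functions on a
  finite measure space, and modulation by exponentials.\<close>

lemma L2_mult_bounded:
  assumes "f \<in> L2 M" "h \<in> borel_measurable M" "\<And>x. x \<in> space M \<Longrightarrow> cmod (h x) \<le> C"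
  shows "(\<lambda>x. h x * f x) \<in> L2 M"
proof -
  have [measurable]: "f \<in> borel_measurable M" "h \<in> borel_measurable M"
    using assms by (auto simp: L2_def)
  have "integrable M (\<lambda>x. (cmod (h x * f x))\<^sup>2)"
  proof (rule Bochner_Integration.integrable_bound)
    show "integrable M (\<lambda>x. C\<^sup>2 * (cmod (f x))\<^sup>2)"
      using assms by (intro integrable_mult_right L2_integrable)
    show "AE x in M. norm ((cmod (h x * f x))\<^sup>2) \<le> norm (C\<^sup>2 * (cmod (f x))\<^sup>2)"
      using assms(3) by (intro AE_I2) (auto simp: norm_mult power_mult_distrib intro!: mult_right_mono power_mono)
  qed measurable
  then show ?thesis by (simp add: L2_def)
qed

lemma L2_cmult: "f \<in> L2 M \<Longrightarrow> (\<lambda>x. c * f x) \<in> L2 M"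
  by (rule L2_mult_bounded[where C = "cmod c"]) auto

lemma L2_diff: "f \<in> L2 M \<Longrightarrow> g \<in> L2 M \<Longrightarrow> (\<lambda>x. f x - g x) \<in> L2 M"
  using L2_add[of f M "\<lambda>x. - 1 * g x"] L2_cmult[of g M "- 1"] by simp

lemma L2_zero [simp]: "(\<lambda>x. 0) \<in> L2 M"
  by (simp add: L2_def)

lemma L2_sum: "(\<And>k. k \<in> J \<Longrightarrow> f k \<in> L2 M) \<Longrightarrow> (\<lambda>x. \<Sum>k\<in>J. f k x) \<in> L2 M"
  by (induction J rule: infinite_finite_induct) (auto intro: L2_add)

lemma (in finite_measure) L2_bounded:
  assumes "f \<in> borel_measurable M" "\<And>x. x \<in> space M \<Longrightarrow> cmod (f x) \<le> C"
  shows "f \<in> L2 M"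
  using L2_mult_bounded[of "\<lambda>x. 1" M f C] assms by (simp add: L2_def)

text \<open>Replaces the triangle inequality, so that all later estimates can stay with squared
  norms, at the price of the factor 2.\<close>

lemma L2_norm_add_sq_le:
  assumes "f \<in> L2 M" "g \<in> L2 M"
  shows "(L2_norm M (\<lambda>x. f x + g x))\<^sup>2 \<le> 2 * (L2_norm M f)\<^sup>2 + 2 * (L2_norm M g)\<^sup>2"
proof -
  have "(\<integral>x. (cmod (f x + g x))\<^sup>2 \<partial>M) \<le> (\<integral>x. 2 * (cmod (f x))\<^sup>2 + 2 * (cmod (g x))\<^sup>2 \<partial>M)"
    using assms by (intro integral_mono L2_integrable L2_add Bochner_Integration.integrable_add integrable_mult_right cmod_add_sq_le)
  also have "\<dots> = 2 * (\<integral>x. (cmod (f x))\<^sup>2 \<partial>M) + 2 * (\<integral>x. (cmod (g x))\<^sup>2 \<partial>M)"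
    using assms by (subst Bochner_Integration.integral_add) (auto intro: L2_integrable)
  finally show ?thesis by (simp add: L2_norm_sq)
qed

lemma L2_norm_cmult_sq: "(L2_norm M (\<lambda>x. c * f x))\<^sup>2 = (cmod c)\<^sup>2 * (L2_norm M f)\<^sup>2"
  by (simp add: L2_norm_sq norm_mult power_mult_distrib)

lemma L2_inner_cnj: "L2_inner M g f = cnj (L2_inner M f g)"
  unfolding L2_inner_def by (simp flip: Bochner_Integration.integral_cnj add: mult.commute)

lemma L2_inner_diff_left:
  "f \<in> L2 M \<Longrightarrow> g \<in> L2 M \<Longrightarrow> h \<in> L2 M \<Longrightarrow>
    L2_inner M (\<lambda>x. f x - g x) h = L2_inner M f h - L2_inner M g h"
  unfolding L2_inner_def
  by (simp add: left_diff_distrib Bochner_Integration.integral_diff L2_integrable_mult_cnj)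

lemma L2_inner_diff_right:
  "f \<in> L2 M \<Longrightarrow> g \<in> L2 M \<Longrightarrow> h \<in> L2 M \<Longrightarrow>
    L2_inner M h (\<lambda>x. f x - g x) = L2_inner M h f - L2_inner M h g"
  unfolding L2_inner_def
  by (simp add: right_diff_distrib Bochner_Integration.integral_diff L2_integrable_mult_cnj)

lemma L2_inner_sum_right:
  assumes "h \<in> L2 M" "\<And>k. k \<in> J \<Longrightarrow> v k \<in> L2 M"
  shows "L2_inner M h (\<lambda>x. \<Sum>k\<in>J. a k * v k x) = (\<Sum>k\<in>J. cnj (a k) * L2_inner M h (v k))"
proof -
  have "L2_inner M h (\<lambda>x. \<Sum>k\<in>J. a k * v k x) = (\<integral>x. (\<Sum>k\<in>J. cnj (a k) * (h x * cnj (v k x))) \<partial>M)"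
    unfolding L2_inner_def by (simp add: sum_distrib_left mult_ac)
  also have "\<dots> = (\<Sum>k\<in>J. \<integral>x. cnj (a k) * (h x * cnj (v k x)) \<partial>M)"
    using assms by (intro Bochner_Integration.integral_sum integrable_mult_right L2_integrable_mult_cnj)
  finally show ?thesis by (simp add: L2_inner_def)
qed

lemma L2_inner_sum_left:
  assumes "h \<in> L2 M" "\<And>k. k \<in> J \<Longrightarrow> v k \<in> L2 M"
  shows "L2_inner M (\<lambda>x. \<Sum>k\<in>J. a k * v k x) h = (\<Sum>k\<in>J. a k * L2_inner M (v k) h)"
  using L2_inner_sum_right[OF assms, where a = a]
  by (subst L2_inner_cnj) (simp add: assms L2_inner_cnj[of M _ h])

section \<open>Orthonormal systems, Bessel's inequality and Parseval's identity\<close>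

definition L2_orthonormal :: "'a measure \<Rightarrow> 'k set \<Rightarrow> ('k \<Rightarrow> 'a \<Rightarrow> complex) \<Rightarrow> bool" where
  "L2_orthonormal M I v \<longleftrightarrow> (\<forall>k\<in>I. v k \<in> L2 M) \<and>
     (\<forall>k\<in>I. \<forall>l\<in>I. L2_inner M (v k) (v l) = (if k = l then 1 else 0))"

text \<open>Completing the square in the coefficients. The identity serves three purposes:
  \<open>f = 0\<close> gives the norm of a finite sum; taking for \<open>a\<close> the Fourier
  coefficients gives Bessel's inequality; and dropping the last sum bounds the defect in Bessel's
  inequality by the error of any approximation supported on \<open>J\<close>.\<close>

lemma orthonormal_approximation_error:
  assumes v: "L2_orthonormal M J v" and J: "finite J" and f: "f \<in> L2 M"
  shows "(L2_norm M (\<lambda>x. f x - (\<Sum>k\<in>J. a k * v k x)))\<^sup>2 =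
    (L2_norm M f)\<^sup>2 - (\<Sum>k\<in>J. (cmod (L2_inner M f (v k)))\<^sup>2) + (\<Sum>k\<in>J. (cmod (L2_inner M f (v k) - a k))\<^sup>2)"
proof -
  let ?s = "\<lambda>x. \<Sum>k\<in>J. a k * v k x" and ?c = "\<lambda>k. L2_inner M f (v k)"
  have vL2: "k \<in> J \<Longrightarrow> v k \<in> L2 M" for k using v by (auto simp: L2_orthonormal_def)
  then have s: "?s \<in> L2 M" by (intro L2_sum L2_cmult)
  have "L2_inner M (v k) ?s = cnj (a k)" if k: "k \<in> J" for k
  proof -
    have "L2_inner M (v k) ?s = (\<Sum>l\<in>J. cnj (a l) * (if k = l then 1 else 0))"
      using v k by (subst L2_inner_sum_right) (auto simp: vL2 L2_orthonormal_def intro!: sum.cong)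
    also have "\<dots> = cnj (a k)" using k J by (simp add: if_distrib[of "\<lambda>x. _ * x"] sum.delta cong: if_cong)
    finally show ?thesis .
  qed
  then have ss: "L2_inner M ?s ?s = (\<Sum>k\<in>J. a k * cnj (a k))"
    using s vL2 by (subst L2_inner_sum_left) (auto intro!: sum.cong)
  have sf: "L2_inner M ?s f = (\<Sum>k\<in>J. a k * cnj (?c k))"
    using f vL2 by (subst L2_inner_sum_left) (auto simp: L2_inner_cnj[of M "v _" f])
  have fs: "L2_inner M f ?s = (\<Sum>k\<in>J. cnj (a k) * ?c k)"
    using f vL2 by (subst L2_inner_sum_right) auto
  have "complex_of_real ((L2_norm M (\<lambda>x. f x - ?s x))\<^sup>2) =
      L2_inner M f f - L2_inner M f ?s - L2_inner M ?s f + L2_inner M ?s ?s"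
    using f s L2_diff[OF f s]
    by (simp only: L2_inner_self[symmetric] L2_inner_diff_left L2_inner_diff_right) (simp add: algebra_simps)
  also have "\<dots> = L2_inner M f f - (\<Sum>k\<in>J. ?c k * cnj (?c k)) + (\<Sum>k\<in>J. (?c k - a k) * cnj (?c k - a k))"
    unfolding ss sf fs by (simp add: algebra_simps sum.distrib sum_subtractf)
  also have "\<dots> = complex_of_real ((L2_norm M f)\<^sup>2 - (\<Sum>k\<in>J. (cmod (?c k))\<^sup>2) + (\<Sum>k\<in>J. (cmod (?c k - a k))\<^sup>2))"
    by (simp add: L2_inner_self complex_norm_square del: complex_cnj_diff of_real_power)
  finally show ?thesis by (rule of_real_eq_iff[THEN iffD1])
qed

lemma orthonormal_sum_norm:
  assumes "L2_orthonormal M J v" "finite J"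
  shows "(L2_norm M (\<lambda>x. \<Sum>k\<in>J. a k * v k x))\<^sup>2 = (\<Sum>k\<in>J. (cmod (a k))\<^sup>2)"
  using orthonormal_approximation_error[OF assms L2_zero, of "\<lambda>k. - a k"]
  by (simp add: L2_inner_def L2_norm_sq sum_negf)

text \<open>If some combination over \<open>J\<close> approximates \<open>f\<close> with squared
  error below \<epsilon>, the partial sum over \<open>J\<close> lies within \<epsilon> of the
  squared norm. Enlarging \<open>J\<close> only increases the partial sum, and Bessel's inequality
  caps it, so the net of finite partial sums converges.\<close>

lemma orthonormal_Parseval:
  assumes v: "L2_orthonormal M I v" and f: "f \<in> L2 M"
    and approx: "\<And>\<epsilon>. \<epsilon> > 0 \<Longrightarrow> \<exists>J a. finite J \<and> J \<subseteq> I \<and> (L2_norm M (\<lambda>x. f x - (\<Sum>k\<in>J. a k * v k x)))\<^sup>2 < \<epsilon>"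
  shows "((\<lambda>k. (cmod (L2_inner M f (v k)))\<^sup>2) has_sum (L2_norm M f)\<^sup>2) I"
proof -
  let ?g = "\<lambda>k. (cmod (L2_inner M f (v k)))\<^sup>2"
  have vJ: "L2_orthonormal M J v" if "J \<subseteq> I" for J
    using v that unfolding L2_orthonormal_def by blast
  have le: "sum ?g J \<le> (L2_norm M f)\<^sup>2" if "finite J" "J \<subseteq> I" for J
    using orthonormal_approximation_error[OF vJ[OF that(2)] that(1) f, of "\<lambda>k. L2_inner M f (v k)"]
      zero_le_power2[of "L2_norm M (\<lambda>x. f x - (\<Sum>k\<in>J. L2_inner M f (v k) * v k x))"]
    by simp
  show ?thesis
    unfolding has_sum_def
  proof (rule tendstoI, goal_cases)
    case (1 \<epsilon>)
    then obtain J a where J: "finite J" "J \<subseteq> I"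
      "(L2_norm M (\<lambda>x. f x - (\<Sum>k\<in>J. a k * v k x)))\<^sup>2 < \<epsilon>"
      using approx by blast
    have "(L2_norm M f)\<^sup>2 - sum ?g J \<le> (L2_norm M (\<lambda>x. f x - (\<Sum>k\<in>J. a k * v k x)))\<^sup>2"
      using orthonormal_approximation_error[OF vJ[OF J(2)] J(1) f, of a] by (simp add: sum_nonneg)
    then have *: "(L2_norm M f)\<^sup>2 - sum ?g J < \<epsilon>" using J(3) by simp
    show ?case
      unfolding eventually_finite_subsets_at_top
    proof (intro exI[of _ J] conjI allI impI)
      fix K assume K: "finite K \<and> J \<subseteq> K \<and> K \<subseteq> I"
      then have "sum ?g J \<le> sum ?g K" by (intro sum_mono2) auto
      with le[of K] K * show "dist (sum ?g K) ((L2_norm M f)\<^sup>2) < \<epsilon>" by (simp add: dist_real_def)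
    qed (use J in auto)
  qed
qed

section \<open>Fourier series on the unit cube\<close>

definition fexp :: "real ^ 'd \<Rightarrow> real ^ 'd \<Rightarrow> complex" where
  "fexp a x = exp (2 * of_real pi * \<i> * of_real (a \<bullet> x))"

lemma fexp_add_left: "fexp (a + b) x = fexp a x * fexp b x"
  by (simp add: fexp_def inner_add_left algebra_simps exp_add)

lemma fexp_add_right: "fexp a (x + y) = fexp a x * fexp a y"
  by (simp add: fexp_def inner_add_right algebra_simps exp_add)

lemma fexp_0_left [simp]: "fexp 0 x = 1"
  by (simp add: fexp_def)

lemma cmod_fexp [simp]: "cmod (fexp a x) = 1"
  by (simp add: fexp_def norm_exp_eq_Re)

lemma cnj_fexp: "cnj (fexp a x) = fexp (- a) x"
  by (simp add: fexp_def exp_cnj)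

lemma continuous_on_fexp: "continuous_on S (fexp a)"
  unfolding fexp_def[abs_def] by (intro continuous_intros)

lemma real_vec_add: "real_vec (m + n) = real_vec m + real_vec n"
  and real_vec_minus: "real_vec (- n) = - real_vec n"
  and real_vec_0 [simp]: "real_vec 0 = 0"
  by (simp_all add: real_vec_def Finite_Cartesian_Product.vec_eq_iff)

text \<open>The inner product of the two vectors is an integer, so the exponent is a multiple of 2
  \<pi> i. This makes integer translations invisible to integer frequencies.\<close>

lemma fexp_real_vec_real_vec [simp]: "fexp (real_vec n) (real_vec m) = 1"
proof -
  have "real_vec n \<bullet> real_vec m = of_int (\<Sum>i\<in>UNIV. n $ i * m $ i)"
    by (simp add: real_vec_def inner_vec_def)
  then have "fexp (real_vec n) (real_vec m) = exp (2 * of_int (\<Sum>i\<in>UNIV. n $ i * m $ i) * of_real pi * \<i>)"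
    unfolding fexp_def by (simp add: mult_ac)
  then show ?thesis
    using exp_integer_2pi[OF Ints_of_int, of "\<Sum>i\<in>UNIV. n $ i * m $ i"] by simp
qed

lemma fexp_measurable [measurable]: "fexp a \<in> borel_measurable borel"
  by (intro borel_measurable_continuous_onI continuous_on_fexp)

lemma fexp_measurable_lebesgue_on: "fexp a \<in> borel_measurable (lebesgue_on S)"
  by (intro measurable_restrict_space1 measurable_completion) simp

lemma L2_norm_modulate_sq: "(L2_norm M (\<lambda>x. fexp a x * f x))\<^sup>2 = (L2_norm M f)\<^sup>2"
  by (simp add: L2_norm_sq norm_mult)

lemma L2_modulate: "f \<in> L2 (lebesgue_on S) \<Longrightarrow> (\<lambda>x. fexp a x * f x) \<in> L2 (lebesgue_on S)"
  by (rule L2_mult_bounded[where C = 1]) (auto intro: fexp_measurable_lebesgue_on)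

lemma unit_cube_Basis: "unit_cube = {x :: real ^ 'd. \<forall>b\<in>Basis. x \<bullet> b \<in> {-1/2..<1/2}}"
  by (auto simp: unit_cube_def Basis_vec_def inner_axis)

lemma unit_cube_borel [measurable]: "(unit_cube :: (real ^ 'd) set) \<in> sets borel"
  unfolding unit_cube_Basis by measurable

lemma bounded_unit_cube: "bounded (unit_cube :: (real ^ 'd) set)"
  by (rule bounded_subset[OF bounded_cbox[of "- (1/2) *\<^sub>R One" "(1/2) *\<^sub>R One"]])
    (auto simp: unit_cube_Basis mem_box less_imp_le)

lemma unit_cube_lmeasurable: "(unit_cube :: (real ^ 'd) set) \<in> lmeasurable"
  by (intro bounded_set_imp_lmeasurable bounded_unit_cube) auto

lemma unit_cube_sets [simp]: "(unit_cube :: (real ^ 'd) set) \<in> sets lebesgue"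
  by auto

lemma finite_measure_unit_cube: "finite_measure (lebesgue_on (unit_cube :: (real ^ 'd) set))"
  by (rule finite_measure_lebesgue_on[OF unit_cube_lmeasurable])

lemma fexp_L2_unit_cube: "fexp a \<in> L2 (lebesgue_on unit_cube)"
  by (rule finite_measure.L2_bounded[OF finite_measure_unit_cube fexp_measurable_lebesgue_on, of _ 1]) simp

text \<open>The fundamental theorem of calculus gives the integral over the closed interval; for
  \<open>k \<noteq> 0\<close> the primitive takes equal values at both ends, as \<open>k\<close> is
  an integer. The endpoint \<open>1/2\<close> is a null set and may be removed. The form
  \<open>has_bochner_integral\<close> also records integrability, which the product formula
  requires.\<close>

lemma has_bochner_integral_exp_unit_interval:
  fixes k :: real
  assumes "k \<in> \<int>"
  shows "has_bochner_integral lborel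
    (\<lambda>t. indicator {-1/2..<1/2} t *\<^sub>R exp (2 * of_real pi * \<i> * of_real (k * t))) (if k = 0 then 1 else 0 :: complex)"
proof -
  let ?f = "\<lambda>t. exp (2 * of_real pi * \<i> * of_real (k * t))"
  let ?F = "\<lambda>t :: real. if k = 0 then complex_of_real t else ?f t / (2 * of_real pi * \<i> * of_real k)"
  have Icc: "has_bochner_integral lborel (\<lambda>t. indicator {-1/2..1/2} t *\<^sub>R ?f t) (?F (1/2) - ?F (-1/2))"
  proof (rule has_bochner_integral_FTC_Icc)
    fix t :: real
    show "(?F has_vector_derivative ?f t) (at t within {-1/2..1/2})"
    proof (cases "k = 0")
      case True
      then show ?thesis by (auto intro!: derivative_eq_intros)
    next
      case False
      have "((\<lambda>z. exp (2 * of_real pi * \<i> * (of_real k * z)) / (2 * of_real pi * \<i> * of_real k)) has_field_derivative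
          ?f t) (at (of_real t))"
        using False by (auto intro!: derivative_eq_intros)
      from has_vector_derivative_real_field[OF this] False show ?thesis
        by simp
    qed
  qed (auto intro!: continuous_intros)
  have F_diff: "?F (1/2) - ?F (-1/2) = (if k = 0 then 1 else 0)"
  proof (cases "k = 0")
    case False
    have "?f (1/2) = ?f (-1/2) * exp (2 * of_real k * of_real pi * \<i>)"
      by (simp add: exp_add[symmetric] algebra_simps)
    moreover have "exp (2 * of_real k * of_real pi * \<i>) = 1"
    proof -
      obtain m where "k = of_int m" using assms by (elim Ints_cases)
      then show ?thesis using exp_integer_2pi[OF Ints_of_int, of m] by (simp only: of_real_of_int_eq of_real_mult of_real_numeral)
    qed
    ultimately have "?f (1/2) = ?f (-1/2)" by (simp only: mult_1_right)
    then show ?thesis using False by (simp only: if_False diff_self)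
  qed simp
  have [measurable]: "?f \<in> borel_measurable borel"
    by (intro borel_measurable_continuous_onI continuous_intros)
  have "has_bochner_integral lborel (\<lambda>t. indicator {-1/2..1/2} t *\<^sub>R ?f t) (if k = 0 then 1 else 0)"
    using Icc unfolding F_diff .
  moreover have "AE t in lborel. indicator {-1/2..1/2} t *\<^sub>R ?f t = indicator {-1/2..<1/2} t *\<^sub>R ?f t"
    using AE_lborel_singleton[of "1/2::real"] by eventually_elim (auto simp: indicator_def)
  ultimately show ?thesis
    by (subst has_bochner_integral_cong_AE[symmetric]) auto
qed

text \<open>\<open>lborel\<close> is the image of the product measure over the basis under the
  coordinate expansion, so the product theorem for integrals applies.\<close>

lemma integral_lborel_prod:
  fixes g :: "'a::euclidean_space \<Rightarrow> real \<Rightarrow> complex"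
  assumes "\<And>b. b \<in> Basis \<Longrightarrow> integrable lborel (g b)"
  shows "(\<integral>x. (\<Prod>b\<in>Basis. g b (x \<bullet> b)) \<partial>lborel) = (\<Prod>b\<in>Basis. \<integral>t. g b t \<partial>lborel)"
proof -
  interpret product_sigma_finite "\<lambda>_ :: 'a. lborel :: real measure" ..
  have [measurable]: "\<And>b. b \<in> Basis \<Longrightarrow> g b \<in> borel_measurable borel"
    using assms[THEN borel_measurable_integrable] by simp
  have "(\<integral>x. (\<Prod>b\<in>Basis. g b (x \<bullet> b)) \<partial>lborel) =
      (\<integral>f. (\<Prod>b\<in>Basis. g b ((\<Sum>c\<in>Basis. f c *\<^sub>R c) \<bullet> b)) \<partial>(\<Pi>\<^sub>M b\<in>Basis. lborel))"
    by (subst lborel_eq, subst integral_distr) measurable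
  also have "\<dots> = (\<integral>f. (\<Prod>b\<in>Basis. g b (f b)) \<partial>(\<Pi>\<^sub>M b\<in>Basis. lborel))"
    by (intro Bochner_Integration.integral_cong refl prod.cong) simp
  also have "\<dots> = (\<Prod>b\<in>Basis. \<integral>t. g b t \<partial>lborel)"
    using assms by (intro product_integral_prod) auto
  finally show ?thesis .
qed

text \<open>Both the indicator of the cube and the exponential factor over the coordinates. The
  integral becomes a product of one-dimensional integrals, each 1 or 0 according to whether that
  coordinate of \<open>n\<close> vanishes.\<close>

lemma integral_fexp_unit_cube:
  fixes n :: "int ^ 'd"
  shows "(\<integral>x. fexp (real_vec n) x \<partial>lebesgue_on unit_cube) = (if n = 0 then 1 else 0)"
proof -
  let ?g = "\<lambda>b t. indicator {-1/2..<1/2} t *\<^sub>R exp (2 * of_real pi * \<i> * of_real ((real_vec n \<bullet> b) * t))"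
  have int: "real_vec n \<bullet> b \<in> \<int>" if "b \<in> Basis" for b
    using that by (auto simp: Basis_vec_def inner_axis real_vec_def)
  note bi = has_bochner_integral_exp_unit_interval[OF int, simplified has_bochner_integral_iff]
  have prod: "indicator unit_cube x *\<^sub>R fexp (real_vec n) x = (\<Prod>b\<in>Basis. ?g b (x \<bullet> b))" for x :: "real ^ 'd"
  proof -
    have "indicator unit_cube x = (\<Prod>b\<in>Basis. indicator {-1/2..<1/2} (x \<bullet> b) :: real)"
      unfolding unit_cube_Basis by (auto simp: indicator_def prod_zero_iff)
    moreover have "fexp (real_vec n) x = (\<Prod>b\<in>Basis. exp (2 * of_real pi * \<i> * of_real ((real_vec n \<bullet> b) * (x \<bullet> b))))"
      unfolding fexp_def by (subst euclidean_inner) (simp add: sum_distrib_left exp_sum)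
    ultimately show ?thesis
      by (simp add: prod.distrib scaleR_conv_of_real of_real_prod)
  qed
  have "(\<integral>x. fexp (real_vec n) x \<partial>lebesgue_on unit_cube) = (\<integral>x. indicator unit_cube x *\<^sub>R fexp (real_vec n) x \<partial>lebesgue)"
    by (subst integral_restrict_space) auto
  also have "\<dots> = (\<integral>x. indicator unit_cube x *\<^sub>R fexp (real_vec n) x \<partial>lborel)"
    by (intro integral_completion) auto
  also have "\<dots> = (\<Prod>b\<in>Basis. \<integral>t. ?g b t \<partial>lborel)"
    unfolding prod using bi by (intro integral_lborel_prod) blast
  also have "\<dots> = (\<Prod>b\<in>(Basis :: (real ^ 'd) set). if real_vec n \<bullet> b = 0 then 1 else 0)"
    using bi by (intro prod.cong) auto
  also have "\<dots> = (if \<forall>b\<in>Basis. real_vec n \<bullet> b = 0 then 1 else 0)"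
    by (auto simp del: euclidean_all_zero_iff)
  also have "(\<forall>b\<in>Basis. real_vec n \<bullet> b = 0) \<longleftrightarrow> real_vec n = 0"
    by (rule euclidean_all_zero_iff)
  also have "real_vec n = 0 \<longleftrightarrow> n = 0"
    by (simp add: real_vec_def Finite_Cartesian_Product.vec_eq_iff)
  finally show ?thesis .
qed

lemma fexp_orthonormal:
  fixes I :: "(int ^ 'd) set"
  shows "L2_orthonormal (lebesgue_on unit_cube) I (\<lambda>n. fexp (real_vec n))"
proof -
  have "L2_inner (lebesgue_on unit_cube) (fexp (real_vec m)) (fexp (real_vec n)) = (if m = n then 1 else 0)" for m n :: "int ^ 'd"
    unfolding L2_inner_def cnj_fexp
    using integral_fexp_unit_cube[of "m - n"]
    by (simp add: fexp_add_left[symmetric] real_vec_minus[symmetric] real_vec_add[symmetric])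
  then show ?thesis by (simp add: L2_orthonormal_def fexp_L2_unit_cube)
qed

section \<open>The algebra of trigonometric polynomials\<close>

inductive trig_poly :: "(real ^ 'd \<Rightarrow> complex) \<Rightarrow> bool" where
  monomial: "trig_poly (\<lambda>x. c * fexp (real_vec n) x)"
| add: "trig_poly f \<Longrightarrow> trig_poly g \<Longrightarrow> trig_poly (\<lambda>x. f x + g x)"

lemma trig_poly_mult_monomial: "trig_poly f \<Longrightarrow> trig_poly (\<lambda>x. c * fexp (real_vec n) x * f x)"
proof (induction rule: trig_poly.induct)
  case (monomial d m)
  show ?case
    using trig_poly.monomial[of "c * d" "n + m"] by (simp add: real_vec_add fexp_add_left mult_ac)
next
  case (add f g)
  then show ?case using trig_poly.add by (simp add: distrib_left)
qed

lemma trig_poly_mult: "trig_poly f \<Longrightarrow> trig_poly g \<Longrightarrow> trig_poly (\<lambda>x. f x * g x)"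
proof (induction rule: trig_poly.induct)
  case (add f1 f2)
  then show ?case using trig_poly.add by (simp add: distrib_right)
qed (rule trig_poly_mult_monomial)

lemma trig_poly_const: "trig_poly (\<lambda>x. c)"
  using trig_poly.monomial[of c 0] by simp

lemma trig_poly_cmult: "trig_poly f \<Longrightarrow> trig_poly (\<lambda>x. c * f x)"
  using trig_poly_mult[OF trig_poly_const] .

text \<open>Passes from the inductive form, convenient for closure properties, to the explicit
  coefficients that Parseval's identity asks for. When two such sums are added, both coefficient
  families are extended by 0 to the union of the supports.\<close>

lemma trig_poly_sum:
  assumes "trig_poly f"
  shows "\<exists>J a. finite J \<and> f = (\<lambda>x. \<Sum>n\<in>J. a n * fexp (real_vec n) x)"
  using assms
proof (induction rule: trig_poly.induct)
  case (monomial c n)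
  show ?case by (intro exI[of _ "{n}"] exI[of _ "\<lambda>_. c"]) simp
next
  case (add f g)
  then obtain J a K b where J: "finite J" "f = (\<lambda>x. \<Sum>n\<in>J. a n * fexp (real_vec n) x)"
    and K: "finite K" "g = (\<lambda>x. \<Sum>n\<in>K. b n * fexp (real_vec n) x)" by blast
  have "f x + g x = (\<Sum>n\<in>J \<union> K. ((if n \<in> J then a n else 0) + (if n \<in> K then b n else 0)) * fexp (real_vec n) x)" for x
  proof -
    have "f x = (\<Sum>n\<in>J \<union> K. (if n \<in> J then a n else 0) * fexp (real_vec n) x)"
      unfolding J(2) using J(1) K(1) by (intro sum.mono_neutral_cong_left) auto
    moreover have "g x = (\<Sum>n\<in>J \<union> K. (if n \<in> K then b n else 0) * fexp (real_vec n) x)"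
      unfolding K(2) using J(1) K(1) by (intro sum.mono_neutral_cong_left) auto
    ultimately show ?thesis by (simp add: distrib_right sum.distrib)
  qed
  then show ?case using J(1) K(1) by (intro exI[of _ "J \<union> K"]) auto
qed

lemma trig_poly_L2: "trig_poly f \<Longrightarrow> f \<in> L2 (lebesgue_on unit_cube)"
  by (induction rule: trig_poly.induct) (auto intro: L2_add L2_cmult fexp_L2_unit_cube)

section \<open>Uniform approximation on the torus\<close>

definition torus_map :: "real ^ 'd \<Rightarrow> complex ^ 'd" where
  "torus_map x = (\<chi> i. cis (2 * pi * x $ i))"

definition torus :: "(complex ^ 'd) set" where
  "torus = {z. \<forall>i. cmod (z $ i) = 1}"

lemma torus_map_in_torus: "torus_map x \<in> torus"
  by (simp add: torus_def torus_map_def)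

lemma compact_torus: "compact (torus :: (complex ^ 'd) set)"
proof -
  have "closed (torus :: (complex ^ 'd) set)"
    unfolding torus_def by (intro closed_Collect_all closed_Collect_eq continuous_intros)
  moreover have "bounded (torus :: (complex ^ 'd) set)"
  proof (rule boundedI)
    fix z :: "complex ^ 'd" assume "z \<in> torus"
    then show "norm z \<le> real CARD('d)"
      using L2_set_le_sum[of UNIV "\<lambda>i. cmod (z $ i)"] by (simp add: torus_def norm_vec_def)
  qed
  ultimately show ?thesis by (simp add: compact_eq_bounded_closed)
qed

lemma continuous_on_torus_map: "continuous_on S torus_map"
  unfolding torus_map_def[abs_def] cis_conv_exp by (intro continuous_intros)

text \<open>Points with the same image differ by integers in each coordinate, and in the half-open
  cube such a difference has modulus below 1. Hence periodic functions can separate the points of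
  the cube.\<close>

lemma inj_on_torus_map: "inj_on (torus_map :: real ^ 'd \<Rightarrow> _) unit_cube"
proof (rule inj_onI)
  fix x y :: "real ^ 'd"
  assume xy: "x \<in> unit_cube" "y \<in> unit_cube" "torus_map x = torus_map y"
  show "x = y"
    unfolding Finite_Cartesian_Product.vec_eq_iff
  proof
    fix i
    have "cis (2 * pi * x $ i) = cis (2 * pi * y $ i)"
      using xy(3) by (simp add: torus_map_def Finite_Cartesian_Product.vec_eq_iff)
    then obtain k :: int where "2 * pi * x $ i = 2 * pi * y $ i + 2 * pi * of_int k"
      by (metis cis.sel sin_cos_eq_iff)
    then have "2 * pi * (x $ i) = 2 * pi * (y $ i + of_int k)" by (simp add: algebra_simps)
    then have k: "x $ i = y $ i + of_int k" by simp
    have "-1/2 \<le> x $ i" "x $ i < 1/2" "-1/2 \<le> y $ i" "y $ i < 1/2"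
      using xy by (auto simp: unit_cube_def)
    with k have "of_int k < (1::real)" "of_int k > (-1::real)" by linarith+
    then have "k = 0" by linarith
    with k show "x $ i = y $ i" by simp
  qed
qed

text \<open>Stone-Weierstrass on the compact torus, for the algebra of continuous real functions
  that become trigonometric polynomials after composition with \<open>torus_map\<close>. By Euler's
  formulas it contains the real and imaginary parts of the coordinates, which separate
  points.\<close>

lemma trig_poly_torus_approx:
  fixes h :: "complex ^ 'd \<Rightarrow> real"
  assumes "continuous_on torus h" "\<epsilon> > 0"
  obtains P where "trig_poly P" "\<And>x. cmod (of_real (h (torus_map x)) - P x) < \<epsilon>"
proof -
  let ?P = "\<lambda>g. continuous_on torus g \<and> trig_poly (\<lambda>x. complex_of_real (g (torus_map x :: complex ^ 'd)))"
  have "\<exists>g. ?P g \<and> (\<forall>z\<in>torus. \<bar>h z - g z\<bar> < \<epsilon>)"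
  proof (rule Stone_Weierstrass_HOL[OF compact_torus, where P = ?P])
    fix z w :: "complex ^ 'd" assume zw: "z \<in> torus \<and> w \<in> torus \<and> z \<noteq> w"
    then obtain i where i: "z $ i \<noteq> w $ i" by (auto simp: Finite_Cartesian_Product.vec_eq_iff)
    have ax: "real_vec (axis i 1) \<bullet> x = x $ i" for x :: "real ^ 'd"
      by (simp add: real_vec_def inner_vec_def axis_def if_distrib[of "\<lambda>x. x * _"] if_distrib[of real_of_int] cong: if_cong)
    have cis: "cis (2 * pi * x $ i) = fexp (real_vec (axis i 1)) x" for x :: "real ^ 'd"
      by (simp add: fexp_def cis_conv_exp ax mult_ac)
    have cis': "cis (- (2 * pi * x $ i)) = fexp (real_vec (- axis i 1)) x" for x :: "real ^ 'd"
      by (simp add: fexp_def cis_conv_exp ax mult_ac real_vec_minus)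
    have Re_eq: "complex_of_real (Re (torus_map x $ i)) = 1/2 * fexp (real_vec (axis i 1)) x + 1/2 * fexp (real_vec (- axis i 1)) x" for x :: "real ^ 'd"
      by (simp flip: cis cis' add: torus_map_def complex_eq_iff)
    have Re: "?P (\<lambda>z. Re (z $ i))"
      unfolding Re_eq by (intro conjI trig_poly.add trig_poly.monomial continuous_intros)
    have Im_eq: "complex_of_real (Im (torus_map x $ i)) = - \<i>/2 * fexp (real_vec (axis i 1)) x + \<i>/2 * fexp (real_vec (- axis i 1)) x" for x :: "real ^ 'd"
      by (simp flip: cis cis' add: torus_map_def complex_eq_iff)
    have Im: "?P (\<lambda>z. Im (z $ i))"
      unfolding Im_eq by (intro conjI trig_poly.add trig_poly.monomial continuous_intros)
    from i have "Re (z $ i) \<noteq> Re (w $ i) \<or> Im (z $ i) \<noteq> Im (w $ i)" by (auto simp: complex_eq_iff)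
    then show "\<exists>f. ?P f \<and> f z \<noteq> f w" using Re Im by blast
  qed (use assms in \<open>auto intro!: continuous_intros trig_poly_const trig_poly.add trig_poly_mult\<close>)
  then obtain g where g: "?P g" "\<And>z. z \<in> torus \<Longrightarrow> \<bar>h z - g z\<bar> < \<epsilon>" by blast
  show thesis
  proof (rule that[of "\<lambda>x. complex_of_real (g (torus_map x))"])
    show "cmod (of_real (h (torus_map x)) - of_real (g (torus_map x))) < \<epsilon>" for x
      using g(2)[OF torus_map_in_torus] by (simp flip: of_real_diff)
  qed (use g in blast)
qed

section \<open>Density of trigonometric polynomials in the square-integrable functions on the
  cube\<close>

definition trig_closure :: "(real ^ 'd \<Rightarrow> complex) set" where
  "trig_closure = {f \<in> L2 (lebesgue_on unit_cube).
     \<forall>\<epsilon>>0. \<exists>P. trig_poly P \<and> (L2_norm (lebesgue_on unit_cube) (\<lambda>x. f x - P x))\<^sup>2 < \<epsilon>}"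

text \<open>The closure is closed. Two approximations with squared error below
  \<open>\<epsilon> / 4\<close> combine to one below \<epsilon>, because
  \<open>L2_norm_add_sq_le\<close> doubles each error.\<close>

lemma trig_closure_limit:
  assumes f: "f \<in> L2 (lebesgue_on unit_cube)"
    and g: "\<And>\<epsilon>. \<epsilon> > 0 \<Longrightarrow> \<exists>g\<in>trig_closure. (L2_norm (lebesgue_on unit_cube) (\<lambda>x. f x - g x))\<^sup>2 < \<epsilon>"
  shows "f \<in> trig_closure"
  unfolding trig_closure_def
proof (intro CollectI conjI allI impI f)
  fix \<epsilon> :: real assume "\<epsilon> > 0"
  then have "\<epsilon> / 4 > 0" by simp
  from g[OF this] obtain g where g: "g \<in> trig_closure" "(L2_norm (lebesgue_on unit_cube) (\<lambda>x. f x - g x))\<^sup>2 < \<epsilon> / 4" by blast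
  then obtain P where P: "trig_poly P" "(L2_norm (lebesgue_on unit_cube) (\<lambda>x. g x - P x))\<^sup>2 < \<epsilon> / 4"
    using \<open>\<epsilon> / 4 > 0\<close> unfolding trig_closure_def by blast
  have gL2: "g \<in> L2 (lebesgue_on unit_cube)" using g(1) by (simp add: trig_closure_def)
  have "(L2_norm (lebesgue_on unit_cube) (\<lambda>x. (f x - g x) + (g x - P x)))\<^sup>2 < \<epsilon>"
    using L2_norm_add_sq_le[OF L2_diff[OF f gL2] L2_diff[OF gL2 trig_poly_L2[OF P(1)]]] g(2) P(2) by linarith
  then show "\<exists>P. trig_poly P \<and> (L2_norm (lebesgue_on unit_cube) (\<lambda>x. f x - P x))\<^sup>2 < \<epsilon>"
    using P(1) by auto
qed

lemma trig_poly_in_closure: "trig_poly P \<Longrightarrow> P \<in> trig_closure"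
  unfolding trig_closure_def by (auto intro!: trig_poly_L2 exI[of _ P] simp: L2_norm_sq)

lemma trig_closure_add:
  assumes "f \<in> trig_closure" "g \<in> trig_closure"
  shows "(\<lambda>x. f x + g x) \<in> trig_closure"
  unfolding trig_closure_def
proof (intro CollectI conjI allI impI)
  have L2: "f \<in> L2 (lebesgue_on unit_cube)" "g \<in> L2 (lebesgue_on unit_cube)"
    using assms by (auto simp: trig_closure_def)
  then show "(\<lambda>x. f x + g x) \<in> L2 (lebesgue_on unit_cube)" by (rule L2_add)
  fix \<epsilon> :: real assume "\<epsilon> > 0"
  then have "\<epsilon> / 4 > 0" by simp
  with assms obtain P Q where P: "trig_poly P" "(L2_norm (lebesgue_on unit_cube) (\<lambda>x. f x - P x))\<^sup>2 < \<epsilon> / 4"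
    and Q: "trig_poly Q" "(L2_norm (lebesgue_on unit_cube) (\<lambda>x. g x - Q x))\<^sup>2 < \<epsilon> / 4"
    unfolding trig_closure_def by blast
  have "(L2_norm (lebesgue_on unit_cube) (\<lambda>x. (f x - P x) + (g x - Q x)))\<^sup>2 < \<epsilon>"
    using L2_norm_add_sq_le[OF L2_diff[OF L2(1) trig_poly_L2[OF P(1)]] L2_diff[OF L2(2) trig_poly_L2[OF Q(1)]]] P(2) Q(2)
    by linarith
  then show "\<exists>P. trig_poly P \<and> (L2_norm (lebesgue_on unit_cube) (\<lambda>x. f x + g x - P x))\<^sup>2 < \<epsilon>"
    using trig_poly.add[OF P(1) Q(1)] by (auto intro!: exI[of _ "\<lambda>x. P x + Q x"] simp: algebra_simps)
qed

lemma trig_closure_cmult: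
  assumes "f \<in> trig_closure"
  shows "(\<lambda>x. c * f x) \<in> trig_closure"
  unfolding trig_closure_def
proof (intro CollectI conjI allI impI)
  show "(\<lambda>x. c * f x) \<in> L2 (lebesgue_on unit_cube)"
    using assms by (intro L2_cmult) (auto simp: trig_closure_def)
  fix \<epsilon> :: real assume e: "\<epsilon> > 0"
  have K: "(cmod c)\<^sup>2 + 1 > 0" by (simp add: add_nonneg_pos)
  with e have "\<epsilon> / ((cmod c)\<^sup>2 + 1) > 0" by simp
  with assms obtain P where P: "trig_poly P" "(L2_norm (lebesgue_on unit_cube) (\<lambda>x. f x - P x))\<^sup>2 < \<epsilon> / ((cmod c)\<^sup>2 + 1)"
    unfolding trig_closure_def by blast
  have "(L2_norm (lebesgue_on unit_cube) (\<lambda>x. c * (f x - P x)))\<^sup>2 \<le> ((cmod c)\<^sup>2 + 1) * (L2_norm (lebesgue_on unit_cube) (\<lambda>x. f x - P x))\<^sup>2"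
    unfolding L2_norm_cmult_sq by (intro mult_right_mono) auto
  also have "\<dots> < \<epsilon>" using P(2) K by (simp add: pos_less_divide_eq mult.commute)
  finally show "\<exists>P. trig_poly P \<and> (L2_norm (lebesgue_on unit_cube) (\<lambda>x. c * f x - P x))\<^sup>2 < \<epsilon>"
    using trig_poly_cmult[OF P(1), of c] by (auto simp: right_diff_distrib)
qed

lemma trig_closure_sum: "(\<And>k. k \<in> J \<Longrightarrow> f k \<in> trig_closure) \<Longrightarrow> (\<lambda>x. \<Sum>k\<in>J. f k x) \<in> trig_closure"
  by (induction J rule: infinite_finite_induct)
    (auto intro: trig_closure_add trig_poly_in_closure trig_poly_const)

lemma LIMSEQ_0_ex_less:
  fixes X :: "nat \<Rightarrow> real"
  assumes "X \<longlonglongrightarrow> 0" "\<epsilon> > 0"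
  shows "\<exists>i. X i < \<epsilon>"
proof -
  have "eventually (\<lambda>i. X i < \<epsilon>) sequentially"
    using order_tendstoD(2)[OF assms] .
  then show ?thesis by (auto simp: eventually_sequentially)
qed

text \<open>Dominated convergence applied to the squared distance; both later approximations, of
  indicators and of general functions, are instances.\<close>

lemma L2_norm_sq_tendsto_0:
  fixes s :: "nat \<Rightarrow> 'a \<Rightarrow> complex"
  assumes f: "f \<in> L2 M" and s: "\<And>i. s i \<in> borel_measurable M"
    and lim: "\<And>x. x \<in> space M \<Longrightarrow> (\<lambda>i. s i x) \<longlonglongrightarrow> f x"
    and w: "integrable M w" and bound: "\<And>i x. x \<in> space M \<Longrightarrow> (cmod (f x - s i x))\<^sup>2 \<le> w x"
  shows "(\<lambda>i. (L2_norm M (\<lambda>x. f x - s i x))\<^sup>2) \<longlonglongrightarrow> 0"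
proof -
  have [measurable]: "f \<in> borel_measurable M" "\<And>i. s i \<in> borel_measurable M"
    using f s by (auto simp: L2_def)
  have "(\<lambda>i. \<integral>x. (cmod (f x - s i x))\<^sup>2 \<partial>M) \<longlonglongrightarrow> (\<integral>x. 0 \<partial>M)"
  proof (rule integral_dominated_convergence[OF _ _ w])
    show "AE x in M. (\<lambda>i. (cmod (f x - s i x))\<^sup>2) \<longlonglongrightarrow> 0"
    proof (rule AE_I2)
      fix x assume "x \<in> space M"
      from lim[OF this] have "(\<lambda>i. (cmod (f x - s i x))\<^sup>2) \<longlonglongrightarrow> (cmod (f x - f x))\<^sup>2"
        by (intro tendsto_intros)
      then show "(\<lambda>i. (cmod (f x - s i x))\<^sup>2) \<longlonglongrightarrow> 0" by simp
    qed
  qed (use bound in auto)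
  then show ?thesis by (simp add: L2_norm_sq)
qed

text \<open>On the torus, the tent functions \<open>h m\<close> equal 1 on the image
  \<open>A\<close> of \<open>K\<close> and decrease to 0 with slope \<open>m\<close> in the distance
  from \<open>A\<close>. Pulled back to the cube they converge pointwise to the indicator of
  \<open>K\<close>, with errors bounded by 1. Each of them is a uniform limit of trigonometric
  polynomials, hence an \<open>L2\<close> limit on a space of finite measure.\<close>

lemma indicator_compact_in_closure:
  fixes K :: "(real ^ 'd) set"
  assumes K: "compact K" "K \<subseteq> unit_cube"
  shows "(indicator K :: _ \<Rightarrow> complex) \<in> trig_closure"
proof (cases "K = {}")
  case True
  then show ?thesis using trig_poly_in_closure[OF trig_poly_const[of 0]] by (simp add: indicator_def[abs_def])
next
  case False
  interpret finite_measure "lebesgue_on (unit_cube :: (real ^ 'd) set)"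
    by (rule finite_measure_unit_cube)
  let ?M = "lebesgue_on (unit_cube :: (real ^ 'd) set)"
  define A where "A = torus_map ` K"
  have A: "closed A" "A \<noteq> {}"
    using False K unfolding A_def by (auto intro!: compact_imp_closed compact_continuous_image continuous_on_torus_map)
  define h where "h m z = max 0 (1 - real m * infdist z A)" for m z
  have h_cont: "continuous_on S (h m)" for S m
    unfolding h_def by (intro continuous_intros)
  have h_bound: "0 \<le> h m z" "h m z \<le> 1" for m z
    by (auto simp: h_def infdist_nonneg)
  let ?h = "\<lambda>m x. complex_of_real (h m (torus_map x))"
  have h_meas: "?h m \<in> borel_measurable ?M" for m
    by (intro measurable_restrict_space1 measurable_completion) 
      (auto intro!: borel_measurable_continuous_onI continuous_intros continuous_on_compose2[OF h_cont[of UNIV]] continuous_on_torus_map)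
  have hL2: "?h m \<in> L2 ?M" for m
    using h_bound by (intro L2_bounded[OF h_meas, where C = 1]) simp
  have K_meas: "(indicator K :: _ \<Rightarrow> complex) \<in> borel_measurable ?M"
    using K(1) by (intro measurable_restrict_space1 measurable_completion borel_measurable_indicator) (simp add: compact_imp_closed borel_closed)
  then have KL2: "(indicator K :: _ \<Rightarrow> complex) \<in> L2 ?M"
    by (intro L2_bounded[where C = 1]) (auto simp: indicator_def)
  have "(\<lambda>m. (L2_norm ?M (\<lambda>x. indicator K x - ?h m x))\<^sup>2) \<longlonglongrightarrow> 0"
  proof (rule L2_norm_sq_tendsto_0[OF KL2 h_meas, where w = "\<lambda>_. 1"])
    fix x :: "real ^ 'd" assume "x \<in> space ?M"
    then have x: "x \<in> unit_cube" by simp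
    show "(\<lambda>m. ?h m x) \<longlonglongrightarrow> indicator K x"
    proof (cases "x \<in> K")
      case True
      then have "h m (torus_map x) = 1" for m by (simp add: h_def A_def)
      then show ?thesis using True by simp
    next
      case False
      \<comment> \<open>Injectivity on the cube keeps the image of \<open>x\<close> off the image of
        \<open>K\<close>; as \<open>A\<close> is closed, the distance is then positive.\<close>
      then have "torus_map x \<notin> A"
        using inj_on_torus_map x K(2) unfolding A_def by (auto dest: inj_onD)
      then have pos: "infdist (torus_map x) A > 0"
        using A infdist_pos_not_in_closed by blast
      have "eventually (\<lambda>m. h m (torus_map x) = 0) sequentially"
        using eventually_ge_at_top[of "nat \<lceil>1 / infdist (torus_map x) A\<rceil>"]
      proof eventually_elim
        case (elim m)
        then have "1 / infdist (torus_map x) A \<le> real m" by linarith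
        then have "1 \<le> real m * infdist (torus_map x) A" using pos by (simp add: divide_le_eq)
        then show ?case by (simp add: h_def)
      qed
      then have "eventually (\<lambda>m. ?h m x = indicator K x) sequentially"
        by eventually_elim (use False in simp)
      then show ?thesis by (rule tendsto_eventually)
    qed
    show "(cmod (indicator K x - ?h m x))\<^sup>2 \<le> 1" for m
    proof -
      have "indicator K x - ?h m x = complex_of_real (indicator K x - h m (torus_map x))"
        by (simp add: indicator_def)
      then have "cmod (indicator K x - ?h m x) = \<bar>indicator K x - h m (torus_map x)\<bar>"
        by (simp only: norm_of_real)
      also have "\<dots> \<le> 1" using h_bound[of m "torus_map x"] by (auto simp: indicator_def)
      finally show ?thesis by (simp add: power_le_one)
    qed
  qed simp
  then have lim: "\<exists>m. (L2_norm ?M (\<lambda>x. indicator K x - ?h m x))\<^sup>2 < \<epsilon>" if "\<epsilon> > 0" for \<epsilon>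
    using that by (rule LIMSEQ_0_ex_less)
  have h_closure: "?h m \<in> trig_closure" for m
    unfolding trig_closure_def
  proof (intro CollectI conjI allI impI hL2)
    fix \<epsilon> :: real assume e: "\<epsilon> > 0"
    define \<mu> where "\<mu> = measure ?M unit_cube"
    have mu: "\<mu> \<ge> 0" by (simp add: \<mu>_def)
    \<comment> \<open>A uniform error \<eta> costs at most \<open>\<eta>\<^sup>2 * \<mu>\<close> in
      squared norm, which this choice puts strictly below \<epsilon>, also for \<mu> equal to
      0.\<close>
    define \<eta> where "\<eta> = sqrt (\<epsilon> / (\<mu> + 1))"
    have eta: "\<eta> > 0" "\<eta>\<^sup>2 = \<epsilon> / (\<mu> + 1)" using e mu by (auto simp: \<eta>_def)
    obtain P where P: "trig_poly P" "\<And>x. cmod (?h m x - P x) < \<eta>"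
      using trig_poly_torus_approx[OF h_cont eta(1)] by metis
    have "(\<integral>x. (cmod (?h m x - P x))\<^sup>2 \<partial>?M) \<le> (\<integral>x. \<eta>\<^sup>2 \<partial>?M)"
      using P(2)[THEN less_imp_le]
      by (intro integral_mono L2_integrable L2_diff hL2 trig_poly_L2 P) (auto intro!: power_mono)
    also have "\<dots> = \<eta>\<^sup>2 * \<mu>" by (simp add: \<mu>_def)
    also have "\<dots> < \<epsilon>" using e mu by (simp add: eta(2) divide_less_eq)
    finally show "\<exists>P. trig_poly P \<and> (L2_norm ?M (\<lambda>x. ?h m x - P x))\<^sup>2 < \<epsilon>"
      using P(1) by (auto simp: L2_norm_sq)
  qed
  show ?thesis
  proof (rule trig_closure_limit[OF KL2])
    fix \<epsilon> :: real assume "\<epsilon> > 0"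
    from lim[OF this] obtain m where "(L2_norm ?M (\<lambda>x. indicator K x - ?h m x))\<^sup>2 < \<epsilon>" ..
    then show "\<exists>g\<in>trig_closure. (L2_norm ?M (\<lambda>x. indicator K x - g x))\<^sup>2 < \<epsilon>"
      by (rule bexI[OF _ h_closure])
  qed
qed

text \<open>Inner regularity: a closed \<open>T\<close> inside \<open>S\<close> omits a set of
  measure below \<epsilon>. It is compact because the cube is bounded, and the squared distance of
  the two indicators is exactly the measure of \<open>S - T\<close>.\<close>

lemma indicator_in_closure:
  fixes S :: "(real ^ 'd) set"
  assumes S: "S \<in> sets (lebesgue_on unit_cube)"
  shows "(indicator S :: _ \<Rightarrow> complex) \<in> trig_closure"
proof (rule trig_closure_limit)
  interpret finite_measure "lebesgue_on (unit_cube :: (real ^ 'd) set)"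
    by (rule finite_measure_unit_cube)
  let ?M = "lebesgue_on (unit_cube :: (real ^ 'd) set)"
  show "(indicator S :: _ \<Rightarrow> complex) \<in> L2 ?M"
    using S by (intro L2_bounded[where C = 1]) (auto simp: indicator_def)
  fix \<epsilon> :: real assume e: "\<epsilon> > 0"
  have S': "S \<in> sets lebesgue" "S \<subseteq> unit_cube"
    using S by (auto simp: sets_restrict_space)
  obtain T where T: "closed T" "T \<subseteq> S" "S - T \<in> lmeasurable" "emeasure lebesgue (S - T) < ennreal \<epsilon>"
    using sets_lebesgue_inner_closed[OF S'(1) e] by blast
  have "bounded T"
    using T(2) S'(2) by (intro bounded_subset[OF bounded_unit_cube]) blast
  then have "compact T"
    using T(1) by (simp add: compact_eq_bounded_closed)
  then have "(indicator T :: _ \<Rightarrow> complex) \<in> trig_closure"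
    using T S' by (intro indicator_compact_in_closure) auto
  moreover have "(L2_norm ?M (\<lambda>x. indicator S x - indicator T x))\<^sup>2 < \<epsilon>"
  proof -
    have "(L2_norm ?M (\<lambda>x. indicator S x - indicator T x))\<^sup>2 = (\<integral>x. indicator (S - T) x \<partial>?M)"
      unfolding L2_norm_sq using T(2) by (intro Bochner_Integration.integral_cong) (auto simp: indicator_def)
    also have "\<dots> = measure ?M (S - T)"
      using S' by (simp add: Int_absorb1 Diff_subset_conv le_supI2 Int_absorb2)
    also have "\<dots> = measure lebesgue (S - T)"
      using S' T by (intro measure_restrict_space) auto
    also have "\<dots> < \<epsilon>"
      using T(3,4) e by (simp add: emeasure_eq_measure2 ennreal_less_iff)
    finally show ?thesis .
  qed
  ultimately show "\<exists>g\<in>trig_closure. (L2_norm ?M (\<lambda>x. indicator S x - g x))\<^sup>2 < \<epsilon>" by blast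
qed

text \<open>Every \<open>f\<close> is an \<open>L2\<close> limit of simple functions, and these are
  finite combinations of indicators of measurable level sets.\<close>

theorem trig_closure_eq_L2: "trig_closure = L2 (lebesgue_on (unit_cube :: (real ^ 'd) set))"
proof
  let ?M = "lebesgue_on (unit_cube :: (real ^ 'd) set)"
  show "trig_closure \<subseteq> L2 ?M" by (auto simp: trig_closure_def)
  show "L2 ?M \<subseteq> trig_closure"
  proof
    fix f assume f: "f \<in> L2 ?M"
    obtain s where s: "\<And>i. simple_function ?M (s i)"
      "\<And>x. x \<in> space ?M \<Longrightarrow> (\<lambda>i. s i x) \<longlonglongrightarrow> f x"
      "\<And>i x. x \<in> space ?M \<Longrightarrow> norm (s i x) \<le> 2 * norm (f x)"
      using borel_measurable_implies_sequence_metric[OF L2_measurable[OF f]] unfolding norm_conv_dist by metis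
    have "(\<lambda>i. (L2_norm ?M (\<lambda>x. f x - s i x))\<^sup>2) \<longlonglongrightarrow> 0"
    proof (rule L2_norm_sq_tendsto_0[OF f])
      \<comment> \<open>The simple functions are bounded by twice the modulus of \<open>f\<close>,
        so the error is at most three times that modulus; 9 is the square of 3.\<close>
      show "integrable ?M (\<lambda>x. 9 * (cmod (f x))\<^sup>2)"
        using L2_integrable[OF f] by simp
      fix i x assume x: "x \<in> space ?M"
      have "cmod (f x - s i x) \<le> 3 * cmod (f x)"
        using norm_triangle_ineq4[of "f x" "s i x"] s(3)[OF x, of i] by linarith
      then have "(cmod (f x - s i x))\<^sup>2 \<le> (3 * cmod (f x))\<^sup>2" by (rule power_mono) simp
      then show "(cmod (f x - s i x))\<^sup>2 \<le> 9 * (cmod (f x))\<^sup>2" by (simp add: power_mult_distrib)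
    qed (use s borel_measurable_simple_function[OF s(1)] in auto)
    then have lim: "\<exists>i. (L2_norm ?M (\<lambda>x. f x - s i x))\<^sup>2 < \<epsilon>" if "\<epsilon> > 0" for \<epsilon>
      using that by (rule LIMSEQ_0_ex_less)
    show "f \<in> trig_closure"
    proof (rule trig_closure_limit[OF f])
      fix \<epsilon> :: real assume "\<epsilon> > 0"
      from lim[OF this] obtain i where i: "(L2_norm ?M (\<lambda>x. f x - s i x))\<^sup>2 < \<epsilon>" ..
      let ?g = "\<lambda>x. \<Sum>y\<in>s i ` space ?M. y * indicator (s i -` {y} \<inter> space ?M) x"
      have "?g \<in> trig_closure"
        using s(1)[of i] by (intro trig_closure_sum trig_closure_cmult indicator_in_closure) (auto simp: simple_function_def)
      moreover have "(L2_norm ?M (\<lambda>x. f x - ?g x))\<^sup>2 = (L2_norm ?M (\<lambda>x. f x - s i x))\<^sup>2"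
      proof -
        have "?g x = s i x" if "x \<in> space ?M" for x
          by (rule sym, rule trans[OF simple_function_indicator_representation_banach[OF s(1) that] sum.cong])
            (auto simp: indicator_def)
        then show ?thesis
          unfolding L2_norm_sq by (intro Bochner_Integration.integral_cong refl) (simp only:)
      qed
      ultimately show "\<exists>g\<in>trig_closure. (L2_norm ?M (\<lambda>x. f x - g x))\<^sup>2 < \<epsilon>"
        using i by (intro bexI[of _ ?g]) (simp only:)
    qed
  qed
qed

lemma trig_approximation:
  assumes "f \<in> L2 (lebesgue_on unit_cube)" "\<epsilon> > 0"
  shows "\<exists>J a. finite J \<and> (L2_norm (lebesgue_on unit_cube) (\<lambda>x. f x - (\<Sum>n\<in>J. a n * fexp (real_vec n) x)))\<^sup>2 < \<epsilon>"
proof -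
  have "f \<in> trig_closure" using assms(1) by (simp add: trig_closure_eq_L2)
  then obtain P where P: "trig_poly P" "(L2_norm (lebesgue_on unit_cube) (\<lambda>x. f x - P x))\<^sup>2 < \<epsilon>"
    using assms(2) unfolding trig_closure_def by blast
  then show ?thesis using trig_poly_sum[OF P(1)] by auto
qed

theorem unit_cube_Parseval:
  assumes "f \<in> L2 (lebesgue_on unit_cube)"
  shows "((\<lambda>n. (cmod (L2_inner (lebesgue_on unit_cube) f (fexp (real_vec n))))\<^sup>2) has_sum
    (L2_norm (lebesgue_on unit_cube) f)\<^sup>2) UNIV"
  by (rule orthonormal_Parseval[OF fexp_orthonormal assms]) (use trig_approximation[OF assms] in auto)

section \<open>Exponentials on unions of cubes\<close>

lemma L2_norm_const_unit_cube: "(L2_norm (lebesgue_on (unit_cube :: (real ^ 'd) set)) (\<lambda>x. c))\<^sup>2 = (cmod c)\<^sup>2"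
proof -
  have "(\<integral>x. complex_of_real 1 \<partial>lebesgue_on (unit_cube :: (real ^ 'd) set)) = 1"
    using integral_fexp_unit_cube[of "0 :: int ^ 'd"] by simp
  then have "measure (lebesgue_on (unit_cube :: (real ^ 'd) set)) unit_cube = 1"
    by (simp only: integral_complex_of_real of_real_eq_1_iff) simp
  then show ?thesis by (simp add: L2_norm_sq)
qed

lemma L2_sum_norm_sq:
  assumes "\<And>k. k \<in> S \<Longrightarrow> f k \<in> L2 M"
  shows "(\<Sum>k\<in>S. (L2_norm M (f k))\<^sup>2) = (\<integral>x. (\<Sum>k\<in>S. (cmod (f k x))\<^sup>2) \<partial>M)"
  unfolding L2_norm_sq using assms by (subst Bochner_Integration.integral_sum) (auto intro: L2_integrable)

text \<open>The inequality holds at every point for the vector of values \<open>F k x\<close>;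
  integration preserves the constant \<open>A\<close>.\<close>

lemma L2_matrix_lower_bound:
  assumes A: "\<And>v. A * (\<Sum>k\<in>T. (cmod (v k))\<^sup>2) \<le> (\<Sum>i\<in>S. (cmod (\<Sum>k\<in>T. B i k * v k))\<^sup>2)"
    and F: "\<And>k. k \<in> T \<Longrightarrow> F k \<in> L2 M"
  shows "A * (\<Sum>k\<in>T. (L2_norm M (F k))\<^sup>2) \<le> (\<Sum>i\<in>S. (L2_norm M (\<lambda>x. \<Sum>k\<in>T. B i k * F k x))\<^sup>2)"
proof -
  have BF: "(\<lambda>x. \<Sum>k\<in>T. B i k * F k x) \<in> L2 M" for i
    using F by (intro L2_sum L2_cmult)
  have "A * (\<Sum>k\<in>T. (L2_norm M (F k))\<^sup>2) = (\<integral>x. A * (\<Sum>k\<in>T. (cmod (F k x))\<^sup>2) \<partial>M)"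
    using F by (simp add: L2_sum_norm_sq)
  also have "\<dots> \<le> (\<integral>x. (\<Sum>i\<in>S. (cmod (\<Sum>k\<in>T. B i k * F k x))\<^sup>2) \<partial>M)"
    using F by (intro integral_mono A integrable_mult_right Bochner_Integration.integrable_sum L2_integrable BF)
  also have "\<dots> = (\<Sum>i\<in>S. (L2_norm M (\<lambda>x. \<Sum>k\<in>T. B i k * F k x))\<^sup>2)"
    using BF by (intro L2_sum_norm_sq[symmetric])
  finally show ?thesis .
qed

lemma L2_matrix_upper_bound:
  assumes F: "\<And>k. k \<in> T \<Longrightarrow> F k \<in> L2 M"
  shows "(\<Sum>i\<in>S. (L2_norm M (\<lambda>x. \<Sum>k\<in>T. B i k * F k x))\<^sup>2)
    \<le> (\<Sum>i\<in>S. \<Sum>k\<in>T. (cmod (B i k))\<^sup>2) * (\<Sum>k\<in>T. (L2_norm M (F k))\<^sup>2)"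
proof -
  let ?K = "\<Sum>i\<in>S. \<Sum>k\<in>T. (cmod (B i k))\<^sup>2"
  have BF: "(\<lambda>x. \<Sum>k\<in>T. B i k * F k x) \<in> L2 M" for i
    using F by (intro L2_sum L2_cmult)
  have "(\<Sum>i\<in>S. (L2_norm M (\<lambda>x. \<Sum>k\<in>T. B i k * F k x))\<^sup>2) = (\<integral>x. (\<Sum>i\<in>S. (cmod (\<Sum>k\<in>T. B i k * F k x))\<^sup>2) \<partial>M)"
    using BF by (intro L2_sum_norm_sq)
  also have "\<dots> \<le> (\<integral>x. ?K * (\<Sum>k\<in>T. (cmod (F k x))\<^sup>2) \<partial>M)"
    using F by (intro integral_mono Frobenius_norm_bound integrable_mult_right Bochner_Integration.integrable_sum L2_integrable BF)
  also have "\<dots> = ?K * (\<Sum>k\<in>T. (L2_norm M (F k))\<^sup>2)"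
    using F by (simp add: L2_sum_norm_sq)
  finally show ?thesis .
qed

text \<open>Translations are affine maps with all scaling factors 1, so the density in the change of
  variables is 1.\<close>

lemma
  fixes c :: "'a::euclidean_space"
  shows measurable_translation_lebesgue: "(\<lambda>x. x + c) \<in> lebesgue \<rightarrow>\<^sub>M lebesgue"
    and distr_translation_lebesgue: "distr lebesgue lebesgue (\<lambda>x. x + c) = lebesgue"
proof -
  have T: "(\<lambda>x. c + (\<Sum>j\<in>Basis. (1 * (x \<bullet> j)) *\<^sub>R j)) = (\<lambda>x. x + c)"
    by (simp add: euclidean_representation add.commute)
  show "(\<lambda>x. x + c) \<in> lebesgue \<rightarrow>\<^sub>M lebesgue"
    using lebesgue_affine_measurable[of "\<lambda>_. 1" c] unfolding T by simp
  show "distr lebesgue lebesgue (\<lambda>x. x + c) = lebesgue"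
    using lebesgue_affine_euclidean[of "\<lambda>_. 1" c] unfolding T by (simp add: density_1)
qed

lemma exp_family_fexp: "exp_family \<delta> (j, n) = fexp (real_vec n + \<delta> j)"
  by (simp add: exp_family_def fexp_def fun_eq_iff)

section \<open>Integration over a disjoint union of translated cubes\<close>

locale separated_cubes =
  fixes N :: nat and M :: "nat \<Rightarrow> int ^ 'd"
  assumes inj_M: "inj_on M {1..N}"
begin

abbreviation Q where "Q \<equiv> lebesgue_on (multi_cube N M)"
abbreviation Q0 where "Q0 \<equiv> lebesgue_on (unit_cube :: (real ^ 'd) set)"

definition cube :: "nat \<Rightarrow> (real ^ 'd) set" where
  "cube p = (\<lambda>x. x + real_vec (M p)) ` unit_cube"

lemma multi_cube_eq: "multi_cube N M = (\<Union>p\<in>{1..N}. cube p)"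
  by (simp add: multi_cube_def cube_def)

text \<open>A common point makes each coordinate of \<open>M p - M q\<close> an integer of modulus
  below 1, hence 0, and \<open>M\<close> is injective on the indices.\<close>

lemma cube_disjoint:
  assumes "p \<in> {1..N}" "q \<in> {1..N}" "x \<in> cube p" "x \<in> cube q"
  shows "p = q"
proof -
  obtain y z where yz: "y \<in> unit_cube" "z \<in> unit_cube" "x = y + real_vec (M p)" "x = z + real_vec (M q)"
    using assms unfolding cube_def by blast
  have "M p $ i = M q $ i" for i
  proof -
    have "y $ i + of_int (M p $ i) = z $ i + of_int (M q $ i)"
      using yz(3,4) by (simp add: Finite_Cartesian_Product.vec_eq_iff real_vec_def)
    moreover have "-1/2 \<le> y $ i" "y $ i < 1/2" "-1/2 \<le> z $ i" "z $ i < 1/2"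
      using yz(1,2) by (auto simp: unit_cube_def)
    ultimately have "\<bar>real_of_int (M p $ i) - of_int (M q $ i)\<bar> < 1" by linarith
    then show ?thesis by linarith
  qed
  then have "M p = M q" by (simp add: Finite_Cartesian_Product.vec_eq_iff)
  then show ?thesis using inj_M assms by (auto dest: inj_onD)
qed

lemma cube_shift_iff: "x + real_vec (M p) \<in> cube p \<longleftrightarrow> x \<in> unit_cube"
  by (auto simp: cube_def)

lemma cube_sets: "cube p \<in> sets lebesgue"
  using lebesgue_sets_translation[OF unit_cube_sets, of "real_vec (M p)"] by (simp add: cube_def add.commute)

lemma cube_subset: "p \<in> {1..N} \<Longrightarrow> cube p \<subseteq> multi_cube N M"
  by (auto simp: multi_cube_eq)

lemma multi_cube_sets: "multi_cube N M \<in> sets lebesgue"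
  unfolding multi_cube_eq by (intro sets.finite_UN cube_sets) simp

lemma finite_measure_multi_cube: "finite_measure Q"
proof (rule finite_measure_lebesgue_on, rule bounded_set_imp_lmeasurable)
  have "bounded (cube p)" for p
    using bounded_translation[OF bounded_unit_cube, of "real_vec (M p)"] by (simp add: cube_def add.commute)
  then show "bounded (multi_cube N M)"
    unfolding multi_cube_eq by (intro bounded_UN) auto
qed (rule multi_cube_sets)

lemma indicator_multi_cube: "(indicator (multi_cube N M) x :: real) = (\<Sum>p=1..N. indicator (cube p) x)"
  unfolding multi_cube_eq
proof (rule indicator_UN_disjoint)
  show "disjoint_family_on cube {1..N}"
    unfolding disjoint_family_on_def using cube_disjoint by blast
qed simp

lemma shift_measurable:
  assumes "f \<in> borel_measurable Q" "p \<in> {1..N}"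
  shows "(\<lambda>x. f (x + real_vec (M p))) \<in> borel_measurable Q0"
proof (rule measurable_compose[OF _ assms(1)])
  show "(\<lambda>x. x + real_vec (M p)) \<in> Q0 \<rightarrow>\<^sub>M Q"
    by (intro measurable_restrict_space3 measurable_translation_lebesgue)
      (auto simp: cube_shift_iff intro!: subsetD[OF cube_subset[OF assms(2)]])
qed

text \<open>The indicator of the union is the sum of the indicators of the disjoint cubes, and
  translation invariance moves each cube onto the unit cube. Integrability on a single cube comes
  from multiplying by its indicator.\<close>

lemma
  fixes f :: "real ^ 'd \<Rightarrow> 'b::{banach, second_countable_topology}"
  assumes f: "integrable Q f"
  shows shift_integrable: "\<And>p. p \<in> {1..N} \<Longrightarrow> integrable Q0 (\<lambda>x. f (x + real_vec (M p)))"
    and integral_multi_cube: "(\<integral>x. f x \<partial>Q) = (\<Sum>p=1..N. \<integral>x. f (x + real_vec (M p)) \<partial>Q0)"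
proof -
  have fQ: "integrable lebesgue (\<lambda>x. indicator (multi_cube N M) x *\<^sub>R f x)"
    using f multi_cube_sets by (simp add: integrable_restrict_space)
  have f_cube: "integrable lebesgue (\<lambda>x. indicator (cube p) x *\<^sub>R f x)" if p: "p \<in> {1..N}" for p
  proof -
    have "indicator (cube p) x *\<^sub>R indicator (multi_cube N M) x *\<^sub>R f x = indicator (cube p) x *\<^sub>R f x" for x
      using cube_subset[OF p] by (auto simp: indicator_def)
    then show ?thesis using integrable_mult_indicator[OF cube_sets fQ, of p] by (simp only:)
  qed
  have ind: "indicator (cube p) (x + real_vec (M p)) = (indicator unit_cube x :: real)" for x p
    by (simp only: indicator_def cube_shift_iff)
  have shifted: "integrable lebesgue (\<lambda>x. indicator unit_cube x *\<^sub>R f (x + real_vec (M p)))"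
    "(\<integral>x. indicator (cube p) x *\<^sub>R f x \<partial>lebesgue) = (\<integral>x. indicator unit_cube x *\<^sub>R f (x + real_vec (M p)) \<partial>lebesgue)"
    if p: "p \<in> {1..N}" for p
  proof -
    let ?g = "\<lambda>x. indicator (cube p) x *\<^sub>R f x"
    have g: "integrable (distr lebesgue lebesgue (\<lambda>x. x + real_vec (M p))) ?g"
      using f_cube[OF p] by (simp only: distr_translation_lebesgue)
    from integrable_distr[OF measurable_translation_lebesgue this]
    show "integrable lebesgue (\<lambda>x. indicator unit_cube x *\<^sub>R f (x + real_vec (M p)))"
      by (simp only: ind)
    have "(\<integral>x. ?g x \<partial>distr lebesgue lebesgue (\<lambda>x. x + real_vec (M p))) = (\<integral>x. ?g (x + real_vec (M p)) \<partial>lebesgue)"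
      by (rule integral_distr[OF measurable_translation_lebesgue borel_measurable_integrable[OF f_cube[OF p]]])
    then show "(\<integral>x. ?g x \<partial>lebesgue) = (\<integral>x. indicator unit_cube x *\<^sub>R f (x + real_vec (M p)) \<partial>lebesgue)"
      by (simp only: distr_translation_lebesgue ind)
  qed
  show "integrable Q0 (\<lambda>x. f (x + real_vec (M p)))" if "p \<in> {1..N}" for p
    using shifted(1)[OF that] by (simp add: integrable_restrict_space)
  have "(\<integral>x. f x \<partial>Q) = (\<integral>x. (\<Sum>p=1..N. indicator (cube p) x) *\<^sub>R f x \<partial>lebesgue)"
    unfolding indicator_multi_cube[symmetric] using multi_cube_sets by (intro integral_restrict_space) simp
  also have "\<dots> = (\<Sum>p=1..N. \<integral>x. indicator (cube p) x *\<^sub>R f x \<partial>lebesgue)"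
    unfolding scaleR_sum_left using f_cube by (rule Bochner_Integration.integral_sum)
  also have "\<dots> = (\<Sum>p=1..N. \<integral>x. f (x + real_vec (M p)) \<partial>Q0)"
  proof (rule sum.cong[OF refl])
    fix p assume "p \<in> {1..N}"
    from shifted(2)[OF this] show "(\<integral>x. indicator (cube p) x *\<^sub>R f x \<partial>lebesgue) = (\<integral>x. f (x + real_vec (M p)) \<partial>Q0)"
      by (simp add: integral_restrict_space)
  qed
  finally show "(\<integral>x. f x \<partial>Q) = (\<Sum>p=1..N. \<integral>x. f (x + real_vec (M p)) \<partial>Q0)" .
qed

lemma shift_L2: "w \<in> L2 Q \<Longrightarrow> p \<in> {1..N} \<Longrightarrow> (\<lambda>x. w (x + real_vec (M p))) \<in> L2 Q0"
  unfolding L2_def using shift_measurable shift_integrable by auto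

lemma L2_norm_multi_cube:
  "w \<in> L2 Q \<Longrightarrow> (L2_norm Q w)\<^sup>2 = (\<Sum>p=1..N. (L2_norm Q0 (\<lambda>x. w (x + real_vec (M p))))\<^sup>2)"
  unfolding L2_norm_sq by (rule integral_multi_cube[OF L2_integrable])

end

section \<open>Analysis and synthesis by the exponential family\<close>

locale exponentials_on_cubes = separated_cubes N M
  for N :: nat and M :: "nat \<Rightarrow> int ^ 'd" +
  fixes \<delta> :: "nat \<Rightarrow> real ^ 'd"
begin

abbreviation index_set :: "(nat \<times> (int ^ 'd)) set" where "index_set \<equiv> {1..N} \<times> UNIV"

definition U :: "nat \<Rightarrow> nat \<Rightarrow> complex" where
  "U j p = fexp (- \<delta> j) (real_vec (M p))"

text \<open>Of the four factors of the shifted exponential, the one pairing \<open>n\<close> with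
  \<open>M p\<close> is 1. What remains of the translation is a number depending only on
  \<open>j\<close> and \<open>p\<close>.\<close>

lemma exp_family_shift:
  "exp_family \<delta> (j, n) (x + real_vec (M p)) = cnj (U j p) * (fexp (\<delta> j) x * fexp (real_vec n) x)"
  by (simp add: exp_family_fexp U_def cnj_fexp fexp_add_left fexp_add_right)

lemma exp_family_L2: "exp_family \<delta> k \<in> L2 Q"
proof (cases k)
  case (Pair j n)
  show ?thesis
    unfolding Pair exp_family_fexp
    by (rule finite_measure.L2_bounded[OF finite_measure_multi_cube fexp_measurable_lebesgue_on, where C = 1]) simp
qed

lemma exp_family_L2_family: "L2_family Q index_set (exp_family \<delta>)"
proof -
  have "inj (\<lambda>n :: int ^ 'd. vec_nth n)" by (simp add: vec_nth_inject inj_def)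
  moreover have "countable (range (\<lambda>n :: int ^ 'd. vec_nth n))"
    by (rule countable_subset[OF _ countable_PiE[of UNIV "\<lambda>_. UNIV :: int set"]]) auto
  ultimately have "countable (UNIV :: (int ^ 'd) set)"
    by (rule countable_image_inj_on[rotated])
  then show ?thesis
    unfolding L2_family_def using exp_family_L2 by (intro conjI countable_SIGMA) auto
qed

text \<open>Translating every cube back to the origin turns the analysis operator into the constant matrix
  \<open>U\<close> followed by modulations and Fourier coefficients.\<close>

lemma L2_inner_exp_family:
  assumes w: "w \<in> L2 Q" and j: "j \<in> {1..N}"
  shows "L2_inner Q w (exp_family \<delta> (j, n)) =
    L2_inner Q0 (\<lambda>x. fexp (- \<delta> j) x * (\<Sum>p=1..N. U j p * w (x + real_vec (M p)))) (fexp (real_vec n))"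
proof -
  let ?f = "\<lambda>x. w x * cnj (exp_family \<delta> (j, n) x)"
  have f: "integrable Q ?f"
    by (rule L2_integrable_mult_cnj[OF w exp_family_L2])
  have "L2_inner Q w (exp_family \<delta> (j, n)) = (\<Sum>p=1..N. \<integral>x. ?f (x + real_vec (M p)) \<partial>Q0)"
    unfolding L2_inner_def by (rule integral_multi_cube[OF f])
  also have "\<dots> = (\<integral>x. (\<Sum>p=1..N. ?f (x + real_vec (M p))) \<partial>Q0)"
    by (rule Bochner_Integration.integral_sum[symmetric]) (rule shift_integrable[OF f])
  also have "\<dots> = L2_inner Q0 (\<lambda>x. fexp (- \<delta> j) x * (\<Sum>p=1..N. U j p * w (x + real_vec (M p)))) (fexp (real_vec n))"
    unfolding L2_inner_def
    by (intro Bochner_Integration.integral_cong refl)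
      (simp add: exp_family_shift cnj_fexp sum_distrib_left sum_distrib_right mult_ac)
  finally show ?thesis .
qed

text \<open>Parseval's identity for every block \<open>j\<close>, where the unimodular factor drops
  out of the norm, followed by a finite sum over the blocks. The form \<open>has_sum\<close> yields
  both the summability and the value needed for a frame.\<close>

lemma analysis_norm:
  assumes w: "w \<in> L2 Q"
  shows "((\<lambda>k. (cmod (L2_inner Q w (exp_family \<delta> k)))\<^sup>2) has_sum
    (\<Sum>j=1..N. (L2_norm Q0 (\<lambda>x. \<Sum>p=1..N. U j p * w (x + real_vec (M p))))\<^sup>2)) index_set"
proof -
  let ?g = "\<lambda>j. (L2_norm Q0 (\<lambda>x. \<Sum>p=1..N. U j p * w (x + real_vec (M p))))\<^sup>2"
  have j: "((\<lambda>n. (cmod (L2_inner Q w (exp_family \<delta> (j, n))))\<^sup>2) has_sum ?g j) UNIV" if j: "j \<in> {1..N}" for j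
  proof -
    have "(\<lambda>x. fexp (- \<delta> j) x * (\<Sum>p=1..N. U j p * w (x + real_vec (M p)))) \<in> L2 Q0"
      by (intro L2_modulate L2_sum L2_cmult shift_L2[OF w])
    from unit_cube_Parseval[OF this] show ?thesis
      by (simp only: L2_norm_modulate_sq L2_inner_exp_family[OF w j])
  qed
  show ?thesis
  proof (rule has_sum_SigmaI[where f = "\<lambda>k. (cmod (L2_inner Q w (exp_family \<delta> k)))\<^sup>2", OF j])
    show "(?g has_sum sum ?g {1..N}) {1..N}" by simp
    show "(\<lambda>k. (cmod (L2_inner Q w (exp_family \<delta> k)))\<^sup>2) summable_on index_set"
      by (rule summable_on_SigmaI[where f = "\<lambda>k. (cmod (L2_inner Q w (exp_family \<delta> k)))\<^sup>2", OF j]) auto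
  qed
qed

text \<open>The dual computation: terms are grouped by \<open>j\<close> into modulated trigonometric
  polynomials \<open>H j\<close>. Orthonormality on the unit cube identifies their norms with those
  of the coefficients, and restriction to the cubes applies the adjoint of \<open>U\<close> to the
  vector \<open>H\<close>.\<close>

lemma synthesis_norm:
  fixes a :: "nat \<times> (int ^ 'd) \<Rightarrow> complex"
  assumes J: "finite J" "J \<subseteq> index_set"
  defines "H \<equiv> \<lambda>j x. fexp (\<delta> j) x * (\<Sum>n\<in>J `` {j}. a (j, n) * fexp (real_vec n) x)"
  shows "\<And>j. H j \<in> L2 Q0"
    and "(\<Sum>j=1..N. (L2_norm Q0 (H j))\<^sup>2) = (\<Sum>k\<in>J. (cmod (a k))\<^sup>2)"
    and "(L2_norm Q (\<lambda>x. \<Sum>k\<in>J. a k * exp_family \<delta> k x))\<^sup>2 =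
      (\<Sum>p=1..N. (L2_norm Q0 (\<lambda>x. \<Sum>j=1..N. cnj (U j p) * H j x))\<^sup>2)"
proof -
  have fin: "finite (J `` {j})" for j
    using J(1) by (rule finite_Image)
  have J_eq: "J = Sigma {1..N} (\<lambda>j. J `` {j})" using J(2) by auto
  have J_sum: "sum g J = (\<Sum>j=1..N. \<Sum>n\<in>J `` {j}. g (j, n))" for g :: "nat \<times> (int ^ 'd) \<Rightarrow> 'e::comm_monoid_add"
    by (subst J_eq, subst sum.Sigma) (auto simp: fin)
  show "H j \<in> L2 Q0" for j
    unfolding H_def by (intro L2_modulate L2_sum L2_cmult fexp_L2_unit_cube)
  have "(L2_norm Q0 (H j))\<^sup>2 = (\<Sum>n\<in>J `` {j}. (cmod (a (j, n)))\<^sup>2)" for j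
    unfolding H_def L2_norm_modulate_sq by (rule orthonormal_sum_norm[OF fexp_orthonormal fin])
  then show "(\<Sum>j=1..N. (L2_norm Q0 (H j))\<^sup>2) = (\<Sum>k\<in>J. (cmod (a k))\<^sup>2)"
    by (simp only: J_sum)
  have "(\<lambda>x. \<Sum>k\<in>J. a k * exp_family \<delta> k x) \<in> L2 Q"
    by (intro L2_sum L2_cmult exp_family_L2)
  moreover have "(\<Sum>k\<in>J. a k * exp_family \<delta> k (x + real_vec (M p))) = (\<Sum>j=1..N. cnj (U j p) * H j x)" for x p
    unfolding H_def J_sum exp_family_shift by (simp add: sum_distrib_left mult_ac)
  ultimately show "(L2_norm Q (\<lambda>x. \<Sum>k\<in>J. a k * exp_family \<delta> k x))\<^sup>2 =
      (\<Sum>p=1..N. (L2_norm Q0 (\<lambda>x. \<Sum>j=1..N. cnj (U j p) * H j x))\<^sup>2)"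
    by (simp only: L2_norm_multi_cube)
qed

text \<open>Analysis amounts to \<open>U\<close> acting on the vector of translates of
  \<open>w\<close>, so the bounds of \<open>U\<close> are frame bounds. The upper constant is
  \<open>K + 1\<close> since a frame bound must be strictly positive.\<close>

lemma frame_if_left_inverse:
  assumes V: "\<And>p q. p \<in> {1..N} \<Longrightarrow> q \<in> {1..N} \<Longrightarrow> (\<Sum>j=1..N. V p j * U j q) = (if p = q then 1 else 0)"
  shows "L2_frame Q index_set (exp_family \<delta>)"
proof -
  obtain A where A: "A > 0"
    "\<And>v. A * (\<Sum>p=1..N. (cmod (v p))\<^sup>2) \<le> (\<Sum>j=1..N. (cmod (\<Sum>p=1..N. U j p * v p))\<^sup>2)"
    using left_inverse_lower_bound[OF V] by blast
  define K where "K = (\<Sum>j=1..N. \<Sum>p=1..N. (cmod (U j p))\<^sup>2)"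
  have K: "K \<ge> 0" by (simp add: K_def sum_nonneg)
  show ?thesis
    unfolding L2_frame_def
  proof (rule conjI[OF exp_family_L2_family], rule exI[of _ A], rule conjI[OF A(1)], rule exI[of _ "K + 1"],
      intro conjI ballI)
    fix w assume w: "w \<in> L2 Q"
    note has_sum = analysis_norm[OF w]
    show "(\<lambda>k. (cmod (L2_inner Q w (exp_family \<delta> k)))\<^sup>2) summable_on index_set"
      using has_sum by (rule has_sum_imp_summable)
    show "A * (L2_norm Q w)\<^sup>2 \<le> (\<Sum>\<^sub>\<infinity>k\<in>index_set. (cmod (L2_inner Q w (exp_family \<delta> k)))\<^sup>2)"
      unfolding infsumI[OF has_sum] L2_norm_multi_cube[OF w]
      by (rule L2_matrix_lower_bound[OF A(2) shift_L2[OF w]])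
    have "(\<Sum>\<^sub>\<infinity>k\<in>index_set. (cmod (L2_inner Q w (exp_family \<delta> k)))\<^sup>2) \<le> K * (L2_norm Q w)\<^sup>2"
      unfolding infsumI[OF has_sum] L2_norm_multi_cube[OF w] K_def
      by (rule L2_matrix_upper_bound[OF shift_L2[OF w]])
    also have "\<dots> \<le> (K + 1) * (L2_norm Q w)\<^sup>2" by (intro mult_right_mono) auto
    finally show "(\<Sum>\<^sub>\<infinity>k\<in>index_set. (cmod (L2_inner Q w (exp_family \<delta> k)))\<^sup>2) \<le> (K + 1) * (L2_norm Q w)\<^sup>2" .
  qed (use K in auto)
qed

lemma Riesz_sequence_if_right_inverse:
  assumes V: "\<And>j k. j \<in> {1..N} \<Longrightarrow> k \<in> {1..N} \<Longrightarrow> (\<Sum>p=1..N. U j p * V p k) = (if j = k then 1 else 0)"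
  shows "L2_Riesz_sequence Q index_set (exp_family \<delta>)"
proof -
  \<comment> \<open>Taking adjoints in \<open>U V = 1\<close> turns the right inverse of
    \<open>U\<close> into a left inverse of its adjoint, the matrix that governs synthesis.\<close>
  have "(\<Sum>p=1..N. cnj (V p j) * cnj (U k p)) = (if j = k then 1 else 0)" if "j \<in> {1..N}" "k \<in> {1..N}" for j k
  proof -
    have eq: "(\<Sum>p=1..N. cnj (V p j) * cnj (U k p)) = cnj (\<Sum>p=1..N. U k p * V p j)"
      by (simp add: mult.commute)
    show ?thesis unfolding eq V[OF that(2,1)] by auto
  qed
  from left_inverse_lower_bound[OF this]
  obtain A where A: "A > 0"
    "\<And>v. A * (\<Sum>j=1..N. (cmod (v j))\<^sup>2) \<le> (\<Sum>p=1..N. (cmod (\<Sum>j=1..N. cnj (U j p) * v j))\<^sup>2)"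
    by blast
  define K where "K = (\<Sum>p=1..N. \<Sum>j=1..N. (cmod (cnj (U j p)))\<^sup>2)"
  have K: "K \<ge> 0" by (simp add: K_def sum_nonneg)
  show ?thesis
    unfolding L2_Riesz_sequence_def
  proof (rule conjI[OF exp_family_L2_family], rule exI[of _ A], rule conjI[OF A(1)], rule exI[of _ "K + 1"],
      intro conjI allI impI)
    fix J a assume J: "finite J \<and> J \<subseteq> index_set"
    let ?H = "\<lambda>j x. fexp (\<delta> j) x * (\<Sum>n\<in>J `` {j}. a (j, n) * fexp (real_vec n) x)"
    note H = synthesis_norm[OF conjunct1[OF J] conjunct2[OF J], where a = a]
    show "A * (\<Sum>k\<in>J. (cmod (a k))\<^sup>2) \<le> (L2_norm Q (\<lambda>x. \<Sum>k\<in>J. a k * exp_family \<delta> k x))\<^sup>2"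
      unfolding H(3) H(2)[symmetric] by (rule L2_matrix_lower_bound[OF A(2) H(1)])
    have "(L2_norm Q (\<lambda>x. \<Sum>k\<in>J. a k * exp_family \<delta> k x))\<^sup>2 \<le> K * (\<Sum>k\<in>J. (cmod (a k))\<^sup>2)"
      unfolding H(3) H(2)[symmetric] K_def by (rule L2_matrix_upper_bound[OF H(1)])
    also have "\<dots> \<le> (K + 1) * (\<Sum>k\<in>J. (cmod (a k))\<^sup>2)" by (intro mult_right_mono sum_nonneg) auto
    finally show "(L2_norm Q (\<lambda>x. \<Sum>k\<in>J. a k * exp_family \<delta> k x))\<^sup>2 \<le> (K + 1) * (\<Sum>k\<in>J. (cmod (a k))\<^sup>2)" .
  qed (use K in auto)
qed

text \<open>The function equal to the constant \<open>v p\<close> on \<open>cube p\<close> is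
  orthogonal to the whole family, because \<open>U v = 0\<close>, but its squared norm is that of
  \<open>v\<close>. This contradicts the lower frame bound.\<close>

lemma not_frame_if_kernel:
  assumes v: "\<exists>p\<in>{1..N}. v p \<noteq> 0" "\<And>j. j \<in> {1..N} \<Longrightarrow> (\<Sum>p=1..N. U j p * v p) = 0"
  shows "\<not> L2_frame Q index_set (exp_family \<delta>)"
proof
  assume "L2_frame Q index_set (exp_family \<delta>)"
  then obtain A where A: "A > 0" and frame: "\<And>w. w \<in> L2 Q \<Longrightarrow>
      A * (L2_norm Q w)\<^sup>2 \<le> (\<Sum>\<^sub>\<infinity>k\<in>index_set. (cmod (L2_inner Q w (exp_family \<delta> k)))\<^sup>2)"
    unfolding L2_frame_def by blast
  define w where "w x = (\<Sum>p=1..N. v p * indicator (cube p) x)" for x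
  have w: "w \<in> L2 Q"
  proof -
    have "indicator (cube p) \<in> L2 Q" for p
    proof (rule finite_measure.L2_bounded[OF finite_measure_multi_cube, where C = 1])
      show "(indicator (cube p) :: _ \<Rightarrow> complex) \<in> borel_measurable Q"
        using cube_sets by (intro measurable_restrict_space1 borel_measurable_indicator)
    qed (auto simp: indicator_def)
    then show ?thesis unfolding w_def[abs_def] by (intro L2_sum L2_cmult)
  qed
  have shift: "w (x + real_vec (M p)) = v p" if p: "p \<in> {1..N}" and x: "x \<in> unit_cube" for x p
  proof -
    have "indicator (cube q) (x + real_vec (M p)) = (if q = p then 1 else 0 :: complex)" if "q \<in> {1..N}" for q
    proof (cases "q = p")
      case False
      then have "x + real_vec (M p) \<notin> cube q"
        using cube_disjoint[OF that p] x cube_shift_iff by blast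
      then show ?thesis using False by simp
    qed (simp add: cube_shift_iff x)
    then have "w (x + real_vec (M p)) = (\<Sum>q=1..N. v q * (if q = p then 1 else 0))"
      unfolding w_def by (intro sum.cong) auto
    then show ?thesis using p by (simp add: if_distrib[of "\<lambda>x. _ * x"] cong: if_cong)
  qed
  have "(L2_norm Q0 (\<lambda>x. \<Sum>p=1..N. U j p * w (x + real_vec (M p))))\<^sup>2 = 0" if j: "j \<in> {1..N}" for j
  proof -
    have "(\<integral>x. (cmod (\<Sum>p=1..N. U j p * w (x + real_vec (M p))))\<^sup>2 \<partial>Q0) = (\<integral>x. 0 \<partial>Q0)"
    proof (intro Bochner_Integration.integral_cong refl)
      fix x assume "x \<in> space Q0"
      then have "(\<Sum>p=1..N. U j p * w (x + real_vec (M p))) = (\<Sum>p=1..N. U j p * v p)"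
        by (intro sum.cong refl) (simp add: shift)
      then show "(cmod (\<Sum>p=1..N. U j p * w (x + real_vec (M p))))\<^sup>2 = 0" using v(2)[OF j] by simp
    qed
    then show ?thesis by (simp add: L2_norm_sq)
  qed
  then have zero: "(\<Sum>\<^sub>\<infinity>k\<in>index_set. (cmod (L2_inner Q w (exp_family \<delta> k)))\<^sup>2) = 0"
    unfolding infsumI[OF analysis_norm[OF w]] by (intro sum.neutral) blast
  have norm: "(L2_norm Q w)\<^sup>2 = (\<Sum>p=1..N. (cmod (v p))\<^sup>2)"
  proof -
    have "(L2_norm Q0 (\<lambda>x. w (x + real_vec (M p))))\<^sup>2 = (L2_norm Q0 (\<lambda>x. v p))\<^sup>2" if "p \<in> {1..N}" for p
      unfolding L2_norm_sq using shift[OF that] by (intro Bochner_Integration.integral_cong) auto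
    then show ?thesis
      unfolding L2_norm_multi_cube[OF w] L2_norm_const_unit_cube by (intro sum.cong) auto
  qed
  have pos: "(\<Sum>p=1..N. (cmod (v p))\<^sup>2) > 0"
    using v(1) by (auto intro!: sum_pos2)
  show False using frame[OF w] mult_pos_pos[OF A pos] unfolding zero norm by linarith
qed

text \<open>The constants \<open>cnj (c j)\<close> are no modulated trigonometric polynomials, but they are \<open>L\<^sup>2\<close>-limits of
  such, which is all that the lower Riesz bound needs to fail.\<close>

lemma not_Riesz_sequence_if_kernel:
  assumes c: "\<exists>j\<in>{1..N}. c j \<noteq> 0" "\<And>p. p \<in> {1..N} \<Longrightarrow> (\<Sum>j=1..N. c j * U j p) = 0"
  shows "\<not> L2_Riesz_sequence Q index_set (exp_family \<delta>)"
proof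
  assume "L2_Riesz_sequence Q index_set (exp_family \<delta>)"
  then obtain A B where A: "A > 0" and bounds: "\<forall>J a. finite J \<and> J \<subseteq> index_set \<longrightarrow>
      A * (\<Sum>k\<in>J. (cmod (a k))\<^sup>2) \<le> (L2_norm Q (\<lambda>x. \<Sum>k\<in>J. a k * exp_family \<delta> k x))\<^sup>2 \<and>
      (L2_norm Q (\<lambda>x. \<Sum>k\<in>J. a k * exp_family \<delta> k x))\<^sup>2 \<le> B * (\<Sum>k\<in>J. (cmod (a k))\<^sup>2)"
    unfolding L2_Riesz_sequence_def by (elim conjE exE) (rule that; assumption)
  note Riesz = conjunct1[OF bounds[rule_format, OF conjI]]
  define K where "K = (\<Sum>p=1..N. \<Sum>j=1..N. (cmod (cnj (U j p)))\<^sup>2)"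
  have K: "K \<ge> 0" by (simp add: K_def sum_nonneg)
  define S where "S = (\<Sum>j=1..N. (cmod (c j))\<^sup>2)"
  have S: "S > 0" unfolding S_def using c(1) by (auto intro!: sum_pos2)
  have N: "real N > 0" using c(1) by auto
  \<comment> \<open>The final estimate will read
    \<open>A * S \<le> 2 * N * (K + A) * \<epsilon>\<close>; this choice makes its right-hand side
    \<open>A * S / 2\<close>, which is absurd.\<close>
  define \<epsilon> where "\<epsilon> = A * S / (4 * N * (K + A))"
  have pos: "4 * N * (K + A) > 0" using A K N by (intro mult_pos_pos) auto
  then have \<epsilon>: "\<epsilon> > 0" unfolding \<epsilon>_def by (intro divide_pos_pos mult_pos_pos[OF A S])
  have \<epsilon>_eq: "4 * N * (K + A) * \<epsilon> = A * S"
    unfolding \<epsilon>_def times_divide_eq_right using pos by (intro nonzero_mult_div_cancel_left) (rule less_imp_neq[symmetric])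
  \<comment> \<open>The constant is demodulated before the approximation: multiplying back by
    \<open>fexp (\<delta> j)\<close> preserves the norm and makes \<open>H j\<close> close to
    \<open>cnj (c j)\<close>.\<close>
  have "\<exists>I b. finite I \<and> (L2_norm Q0 (\<lambda>x. cnj (c j) * fexp (- \<delta> j) x - (\<Sum>n\<in>I. b n * fexp (real_vec n) x)))\<^sup>2 < \<epsilon>" for j
    by (rule trig_approximation[OF L2_cmult[OF fexp_L2_unit_cube] \<epsilon>])
  then have "\<exists>I. \<forall>j. \<exists>b. finite (I j) \<and>
      (L2_norm Q0 (\<lambda>x. cnj (c j) * fexp (- \<delta> j) x - (\<Sum>n\<in>I j. b n * fexp (real_vec n) x)))\<^sup>2 < \<epsilon>"
    by (intro choice allI)
  then obtain I where "\<forall>j. \<exists>b. finite (I j) \<and>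
      (L2_norm Q0 (\<lambda>x. cnj (c j) * fexp (- \<delta> j) x - (\<Sum>n\<in>I j. b n * fexp (real_vec n) x)))\<^sup>2 < \<epsilon>" ..
  then have "\<exists>b. \<forall>j. finite (I j) \<and>
      (L2_norm Q0 (\<lambda>x. cnj (c j) * fexp (- \<delta> j) x - (\<Sum>n\<in>I j. b j n * fexp (real_vec n) x)))\<^sup>2 < \<epsilon>"
    by (rule choice)
  then obtain b where Ib: "\<forall>j. finite (I j) \<and>
      (L2_norm Q0 (\<lambda>x. cnj (c j) * fexp (- \<delta> j) x - (\<Sum>n\<in>I j. b j n * fexp (real_vec n) x)))\<^sup>2 < \<epsilon>" ..
  note I = conjunct1[OF spec[OF Ib]] and approx = conjunct2[OF spec[OF Ib]]
  define J where "J = Sigma {1..N} I"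
  define a where "a = (\<lambda>(j, n). b j n)"
  define H where "H j x = fexp (\<delta> j) x * (\<Sum>n\<in>J `` {j}. a (j, n) * fexp (real_vec n) x)" for j x
  have J: "finite J" "J \<subseteq> index_set" using I by (auto simp: J_def)
  note syn = synthesis_norm[OF J, where a = a, folded H_def]
  define R where "R j x = cnj (c j) - H j x" for j x
  have R_L2: "R j \<in> L2 Q0" for j
  proof -
    have "(\<lambda>x. cnj (c j)) \<in> L2 Q0"
      by (rule finite_measure.L2_bounded[OF finite_measure_unit_cube, where C = "cmod (c j)"]) auto
    then show ?thesis unfolding R_def[abs_def] by (intro L2_diff syn(1))
  qed
  have R_small: "(L2_norm Q0 (R j))\<^sup>2 < \<epsilon>" if j: "j \<in> {1..N}" for j
  proof -
    have "J `` {j} = I j" using j by (auto simp: J_def)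
    then have "R j x = fexp (\<delta> j) x * (cnj (c j) * fexp (- \<delta> j) x - (\<Sum>n\<in>I j. b j n * fexp (real_vec n) x))" for x
      unfolding R_def H_def a_def
      by (simp add: right_diff_distrib mult.left_commute[of "fexp _ _" "cnj _"] flip: fexp_add_left)
    then have "R j = (\<lambda>x. fexp (\<delta> j) x * (cnj (c j) * fexp (- \<delta> j) x - (\<Sum>n\<in>I j. b j n * fexp (real_vec n) x)))"
      by (rule ext)
    then show ?thesis using approx[of j] by (simp only: L2_norm_modulate_sq)
  qed
  have R_sum: "(\<Sum>j=1..N. (L2_norm Q0 (R j))\<^sup>2) \<le> N * \<epsilon>"
    using sum_mono[of "{1..N}" "\<lambda>j. (L2_norm Q0 (R j))\<^sup>2" "\<lambda>_. \<epsilon>"] R_small by (simp add: less_imp_le)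
  \<comment> \<open>The adjoint of \<open>U\<close> annihilates the constant vector with entries
    \<open>cnj (c j)\<close>, so it sends \<open>H\<close> to minus the image of the small remainder
    \<open>R\<close>. Synthesis of \<open>H\<close> is therefore small.\<close>
  have HR: "(L2_norm Q0 (\<lambda>x. \<Sum>j=1..N. cnj (U j p) * H j x))\<^sup>2 = (L2_norm Q0 (\<lambda>x. \<Sum>j=1..N. cnj (U j p) * R j x))\<^sup>2"
    if p: "p \<in> {1..N}" for p
  proof -
    have "(\<Sum>j=1..N. cnj (U j p) * cnj (c j)) = cnj (\<Sum>j=1..N. c j * U j p)"
      by (simp add: mult.commute)
    also have "\<dots> = 0" by (simp only: c(2)[OF p] complex_cnj_zero)
    finally have "(\<Sum>j=1..N. cnj (U j p) * R j x) = - (\<Sum>j=1..N. cnj (U j p) * H j x)" for x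
      by (simp add: R_def right_diff_distrib sum_subtractf)
    then show ?thesis by (simp add: L2_norm_sq)
  qed
  have "A * (\<Sum>j=1..N. (L2_norm Q0 (H j))\<^sup>2) \<le> (\<Sum>p=1..N. (L2_norm Q0 (\<lambda>x. \<Sum>j=1..N. cnj (U j p) * H j x))\<^sup>2)"
    using Riesz[OF J, of a] unfolding syn(3) syn(2)[symmetric] .
  also have "\<dots> = (\<Sum>p=1..N. (L2_norm Q0 (\<lambda>x. \<Sum>j=1..N. cnj (U j p) * R j x))\<^sup>2)"
    by (intro sum.cong refl HR)
  also have "\<dots> \<le> K * (\<Sum>j=1..N. (L2_norm Q0 (R j))\<^sup>2)"
    unfolding K_def by (rule L2_matrix_upper_bound[OF R_L2])
  also have "\<dots> \<le> K * (N * \<epsilon>)" using K by (intro mult_left_mono R_sum)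
  finally have upper: "A * (\<Sum>j=1..N. (L2_norm Q0 (H j))\<^sup>2) \<le> K * (N * \<epsilon>)" .
  \<comment> \<open>Conversely \<open>H\<close> cannot be small itself: \<open>R j + H j\<close> is
    the constant \<open>cnj (c j)\<close>, and the cube has measure 1.\<close>
  have "(cmod (c j))\<^sup>2 \<le> 2 * (L2_norm Q0 (R j))\<^sup>2 + 2 * (L2_norm Q0 (H j))\<^sup>2" for j
  proof -
    have "(\<lambda>x. R j x + H j x) = (\<lambda>x. cnj (c j))" by (simp add: R_def)
    then show ?thesis
      using L2_norm_add_sq_le[OF R_L2 syn(1), of j j] by (simp only: L2_norm_const_unit_cube complex_mod_cnj)
  qed
  then have "S \<le> (\<Sum>j=1..N. 2 * (L2_norm Q0 (R j))\<^sup>2 + 2 * (L2_norm Q0 (H j))\<^sup>2)"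
    unfolding S_def by (intro sum_mono)
  also have "\<dots> \<le> 2 * (N * \<epsilon>) + 2 * (\<Sum>j=1..N. (L2_norm Q0 (H j))\<^sup>2)"
    using R_sum by (simp add: sum.distrib sum_distrib_left[symmetric])
  finally have "A * S \<le> A * (2 * (N * \<epsilon>) + 2 * (\<Sum>j=1..N. (L2_norm Q0 (H j))\<^sup>2))"
    using A by (intro mult_left_mono) auto
  also have "\<dots> \<le> 2 * (A * (N * \<epsilon>)) + 2 * (K * (N * \<epsilon>))"
    using upper by (simp add: distrib_left)
  also have "\<dots> = 2 * N * (K + A) * \<epsilon>" by (simp add: algebra_simps)
  also have "\<dots> = A * S / 2" using \<epsilon>_eq by simp
  finally show False using mult_pos_pos[OF A S] by simp
qed

end

theorem theorem1p2:
  fixes N :: nat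
    and M :: "nat \<Rightarrow> int ^ 'd"
    and \<delta> :: "nat \<Rightarrow> real ^ 'd"
  assumes "N \<ge> 1"
    and "inj_on M {1..N}"
  shows "(L2_Riesz_sequence (lebesgue_on (multi_cube N M)) ({1..N} \<times> UNIV) (exp_family \<delta>) \<longleftrightarrow>
            L2_frame (lebesgue_on (multi_cube N M)) ({1..N} \<times> UNIV) (exp_family \<delta>)) \<and>
         (L2_frame (lebesgue_on (multi_cube N M)) ({1..N} \<times> UNIV) (exp_family \<delta>) \<longleftrightarrow>
            L2_Riesz_basis (lebesgue_on (multi_cube N M)) ({1..N} \<times> UNIV) (exp_family \<delta>))"
proof -
  interpret exponentials_on_cubes N M \<delta>
    by unfold_locales (rule assms(2))
  \<comment> \<open>The three properties always share their truth value: all hold when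
    \<open>U\<close> is invertible, and all fail when it is singular.\<close>
  show ?thesis
  proof (cases rule: square_system_alternative[of N U])
    case (invertible V)
    have "L2_frame Q index_set (exp_family \<delta>)"
      using invertible(1) by (rule frame_if_left_inverse)
    moreover have "L2_Riesz_sequence Q index_set (exp_family \<delta>)"
      using invertible(2) by (rule Riesz_sequence_if_right_inverse)
    ultimately show ?thesis unfolding L2_Riesz_basis_def by blast
  next
    case (singular v c)
    have "\<not> L2_frame Q index_set (exp_family \<delta>)"
      using singular(1,2) by (rule not_frame_if_kernel)
    moreover have "\<not> L2_Riesz_sequence Q index_set (exp_family \<delta>)"
      using singular(3,4) by (rule not_Riesz_sequence_if_kernel)
    ultimately show ?thesis unfolding L2_Riesz_basis_def by blast
  qed
qed

end
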